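(* Let $\gamma=4/3$, $A>0$, $0<\mu_0<\mu_1<\infty$, $\mu\in[\mu_0,\mu_1]$, and let $\varepsilon>0$ be small enough (depending on $\mu_0,\mu_1$). Let $\rho_{\mu,\varepsilon}$ be the uniformly rotating supermassive star, $f_{\mu,\varepsilon}$ its self-similar direction, and $G_{\mu,\varepsilon}=L_{\mu,\varepsilon}+6\pi\varepsilon^2T_{\mu,\varepsilon}$. Then for any $\delta\rho\in R(B_1^{\mu,\varepsilon})$, $$\langle G_{\mu,\varepsilon}f_{\mu,\varepsilon},\delta\rho\rangle=0.$$ In particular $\langle G_{\mu,\varepsilon}f_{\mu,\varepsilon},f_{\mu,\varepsilon}\rangle=0$, i.e. $f_{\mu,\varepsilon}$ lies in the reduced kernel of $G_{\mu,\varepsilon}|_{R(B_1^{\mu,\varepsilon})}$.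
   Context: Cylindrical coordinates $r=\sqrt{x_1^2+x_2^2}$, $z=x_3$; everything is axi-symmetric and sets of points $(r,z)$ are identified with bodies of revolution in $\mathbb{R}^3$. For $\gamma=4/3$: $\Phi'(\rho)=4A\rho^{1/3}$, $\Phi''(\rho)=\frac43A\rho^{-2/3}$. Star: $\rho_{\mu,\varepsilon}\ge0$ (extended by zero outside its support) is the admissible solution, with central density $\rho_{\mu,\varepsilon}(0,0)=\mu$, of $-\frac12\varepsilon^2r^2+\Phi'(\rho_{\mu,\varepsilon})+V_{\mu,\varepsilon}+c_{\mu,\varepsilon}=0$ in $\Omega_{\mu,\varepsilon}=\{\rho_{\mu,\varepsilon}>0\}$, $V_{\mu,\varepsilon}=-|x|^{-1}*\rho_{\mu,\varepsilon}$, $c_{\mu,\varepsilon}=-V_{\mu,\varepsilon}(0,Z_{\mu,\varepsilon})$, $(0,\pm Z_{\mu,\varepsilon})$ being the poles of the star. Admissible means, with $R=|x|$, $\zeta=x_3/R$: (I) $\partial_R\rho<0$ for $R_0\le R\le R_\infty$, for some small $R_0>0$ and some $R_\infty>R_0$; (II) there is a continuous $R(\zeta)\in[R_0,R_\infty]$, $|\zeta|\le1$, with $\rho(R,\zeta)>0$ iff $R<R(\zeta)$; (III) $\rho$ is continuous, $\rho(0,\zeta)=\mu$, $\rho(R,-\zeta)=\rho(R,\zeta)$. Known from the literature: for $\varepsilon>0$ small (uniformly in $\mu\in[\mu_0,\mu_1]$) this solution exists and is unique, $\partial\Omega_{\mu,\varepsilon}$ is $C^2$ with positive curvature near the equator $(R_{\mu,\varepsilon},0)$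 ($R_{\mu,\varepsilon}$ is the equatorial radius), and $\rho_{\mu,\varepsilon}\approx\operatorname{dist}(\cdot,\partial\Omega_{\mu,\varepsilon})^3$ near the boundary. Spaces and forms: $X_1^{\mu,\varepsilon}=L^2_{\Phi''(\rho_{\mu,\varepsilon})}$, the axi-symmetric $L^2$ space on $\Omega_{\mu,\varepsilon}$ with weight $\Phi''(\rho_{\mu,\varepsilon})$; $R(B_1^{\mu,\varepsilon})=\{\delta\rho\in X_1^{\mu,\varepsilon}:\int_{\Omega_{\mu,\varepsilon}}\delta\rho\,dx=0\}$. $L_{\mu,\varepsilon}=\Phi''(\rho_{\mu,\varepsilon})-4\pi(-\Delta)^{-1}:X_1^{\mu,\varepsilon}\to(X_1^{\mu,\varepsilon})^*$, i.e. $\langle L_{\mu,\varepsilon}\sigma,\tau\rangle=\int\Phi''(\rho_{\mu,\varepsilon})\sigma\tau\,dx-\iint\frac{\sigma(x)\tau(y)}{|x-y|}dx\,dy$. With $F_{\delta\rho}(r)=\int_0^rs\int_{\mathbb{R}}\delta\rho(s,z)\,dz\,ds$, $T_{\mu,\varepsilon}:X_1^{\mu,\varepsilon}\to(X_1^{\mu,\varepsilon})^*$ is the symmetric operator given by $\langle T_{\mu,\varepsilon}\sigma,\tau\rangle=\int_0^{R_{\mu,\varepsilon}}\frac{F_\sigma(r)F_\tau(r)}{r\int_{\mathbb{R}}\rho_{\mu,\varepsilon}(r,z)dz}\,dr$. Self-similar direction: $\rho_\lambda(r,z)=\lambda^3\rho_{\mu,\varepsilon}(\lambda r,\lambda z)$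 for $\lambda>0$ and $f_{\mu,\varepsilon}=\partial_\lambda\rho_\lambda|_{\lambda=1}$, which belongs to $R(B_1^{\mu,\varepsilon})$ because the mass $\int\rho_\lambda dx$ does not depend on $\lambda$. *)

theory Defs
  imports "HOL-Analysis.Analysis"
begin

section \<open>Axi-symmetric functions\<close>

definition cyl_radius :: "real ^ 3 \<Rightarrow> real" where
  "cyl_radius x = sqrt ((x $ 1)\<^sup>2 + (x $ 2)\<^sup>2)"

definition cyl_point :: "real \<Rightarrow> real \<Rightarrow> real ^ 3" where
  "cyl_point r z = vector [r, 0, z]"

text \<open>The point with \<open>|x| = R\<close> and \<open>x\<^sub>3 / |x| = \<zeta>\<close> (in the half-plane \<open>x\<^sub>2 = 0\<close>, \<open>x\<^sub>1 \<ge> 0\<close>).\<close>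

definition sph_point :: "real \<Rightarrow> real \<Rightarrow> real ^ 3" where
  "sph_point R \<zeta> = cyl_point (R * sqrt (1 - \<zeta>\<^sup>2)) (R * \<zeta>)"

definition axisymmetric :: "(real ^ 3 \<Rightarrow> real) \<Rightarrow> bool" where
  "axisymmetric g \<longleftrightarrow>
     (\<forall>x y. cyl_radius x = cyl_radius y \<and> x $ 3 = y $ 3 \<longrightarrow> g x = g y)"


section \<open>The rotating star\<close>

text \<open>\<open>\<Phi>'\<close> and \<open>\<Phi>''\<close> for the exponent \<open>\<gamma> = 4/3\<close>.\<close>

definition dPhi :: "real \<Rightarrow> real \<Rightarrow> real" where
  "dPhi A s = 4 * A * s powr (1/3)"

definition ddPhi :: "real \<Rightarrow> real \<Rightarrow> real" where
  "ddPhi A s = 4/3 * A * s powr (-2/3)"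

definition star_region :: "(real ^ 3 \<Rightarrow> real) \<Rightarrow> (real ^ 3) set" where
  "star_region \<rho> = {x. 0 < \<rho> x}"

definition potential :: "(real ^ 3 \<Rightarrow> real) \<Rightarrow> real ^ 3 \<Rightarrow> real" where
  "potential \<rho> x = - (LINT y|lborel. \<rho> y / norm (x - y))"

definition pole_height :: "(real ^ 3 \<Rightarrow> real) \<Rightarrow> real" where
  "pole_height \<rho> = Sup {z. cyl_point 0 z \<in> star_region \<rho>}"

text \<open>The radius of the equator, the circle of the star's boundary farthest from the axis of
  rotation. It is expressed as the largest distance from the axis, so that \<open>(0, R)\<close> is exactly
  the range of cylindrical radii occurring in the star.\<close>

definition equatorial_radius :: "(real ^ 3 \<Rightarrow> real) \<Rightarrow> real" where
  "equatorial_radius \<rho> = Sup (cyl_radius ` star_region \<rho>)"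

text \<open>In the first clause the inequality \<open>\<partial>\<^sub>R \<rho> < 0\<close> is demanded only inside the star: \<open>\<rho>\<close> is
  extended by zero, so \<open>\<partial>\<^sub>R \<rho>\<close> cannot be negative at or beyond the boundary \<open>R = R(\<zeta>)\<close>, although
  \<open>R(\<zeta>) \<in> [R\<^sub>0, R\<^sub>\<infinity>]\<close>.\<close>

definition admissible :: "real \<Rightarrow> (real ^ 3 \<Rightarrow> real) \<Rightarrow> bool" where
  "admissible \<mu> \<rho> \<longleftrightarrow>
     (\<forall>x. 0 \<le> \<rho> x) \<and> axisymmetric \<rho> \<and>
     (\<exists>R0 Rinf. 0 < R0 \<and> R0 < Rinf \<and>
        (\<forall>R\<in>{R0..Rinf}. \<forall>\<zeta>\<in>{-1..1}. 0 < \<rho> (sph_point R \<zeta>) \<longrightarrow>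
           (\<exists>D<0. ((\<lambda>t. \<rho> (sph_point t \<zeta>)) has_real_derivative D) (at R))) \<and>
        (\<exists>Rb. continuous_on {-1..1} Rb \<and> Rb ` {-1..1} \<subseteq> {R0..Rinf} \<and>
           (\<forall>R\<ge>0. \<forall>\<zeta>\<in>{-1..1}. 0 < \<rho> (sph_point R \<zeta>) \<longleftrightarrow> R < Rb \<zeta>))) \<and>
     continuous_on UNIV \<rho> \<and>
     \<rho> 0 = \<mu> \<and>
     (\<forall>R\<ge>0. \<forall>\<zeta>\<in>{-1..1}. \<rho> (sph_point R (- \<zeta>)) = \<rho> (sph_point R \<zeta>))"

definition rotating_star :: "real \<Rightarrow> real \<Rightarrow> real \<Rightarrow> (real ^ 3 \<Rightarrow> real) \<Rightarrow> bool" where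
  "rotating_star A \<mu> \<epsilon> \<rho> \<longleftrightarrow>
     admissible \<mu> \<rho> \<and>
     (let c = - potential \<rho> (cyl_point 0 (pole_height \<rho>)) in
      \<forall>x\<in>star_region \<rho>.
        - 1/2 * \<epsilon>\<^sup>2 * (cyl_radius x)\<^sup>2 + dPhi A (\<rho> x) + potential \<rho> x + c = 0)"


section \<open>Function spaces and quadratic forms\<close>

text \<open>Elements of the weighted \<open>L\<^sup>2\<close> spaces are represented by Borel measurable, axi-symmetric
  functions on the whole space that vanish outside the star.\<close>

definition X1 :: "real \<Rightarrow> (real ^ 3 \<Rightarrow> real) \<Rightarrow> (real ^ 3 \<Rightarrow> real) set" where
  "X1 A \<rho> = {\<sigma>. \<sigma> \<in> borel_measurable borel \<and> axisymmetric \<sigma> \<and>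
     (\<forall>x. x \<notin> star_region \<rho> \<longrightarrow> \<sigma> x = 0) \<and>
     set_integrable lborel (star_region \<rho>) (\<lambda>x. ddPhi A (\<rho> x) * (\<sigma> x)\<^sup>2)}"

definition RB1 :: "real \<Rightarrow> (real ^ 3 \<Rightarrow> real) \<Rightarrow> (real ^ 3 \<Rightarrow> real) set" where
  "RB1 A \<rho> = {\<sigma> \<in> X1 A \<rho>. (LINT x:star_region \<rho>|lborel. \<sigma> x) = 0}"

text \<open>The operators from \<open>X\<^sub>1\<close> to its dual are curried: \<open>op_L A \<rho> \<sigma> \<tau>\<close> is the pairing
  \<open>\<langle>L \<sigma>, \<tau>\<rangle>\<close>, and likewise for \<open>op_T\<close> and \<open>op_G\<close>.\<close>

definition op_L ::
  "real \<Rightarrow> (real ^ 3 \<Rightarrow> real) \<Rightarrow> (real ^ 3 \<Rightarrow> real) \<Rightarrow> (real ^ 3 \<Rightarrow> real) \<Rightarrow> real" where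
  "op_L A \<rho> \<sigma> \<tau> =
     (LINT x:star_region \<rho>|lborel. ddPhi A (\<rho> x) * \<sigma> x * \<tau> x)
     - (LINT p|(lborel \<Otimes>\<^sub>M lborel). \<sigma> (fst p) * \<tau> (snd p) / norm (fst p - snd p))"

definition column :: "(real ^ 3 \<Rightarrow> real) \<Rightarrow> real \<Rightarrow> real" where
  "column \<sigma> r = (LINT z|lborel. \<sigma> (cyl_point r z))"

definition flux :: "(real ^ 3 \<Rightarrow> real) \<Rightarrow> real \<Rightarrow> real" where
  "flux \<sigma> r = (LINT s:{0..r}|lborel. s * column \<sigma> s)"

definition op_T ::
  "(real ^ 3 \<Rightarrow> real) \<Rightarrow> (real ^ 3 \<Rightarrow> real) \<Rightarrow> (real ^ 3 \<Rightarrow> real) \<Rightarrow> real" where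
  "op_T \<rho> \<sigma> \<tau> =
     (LINT r:{0..equatorial_radius \<rho>}|lborel. flux \<sigma> r * flux \<tau> r / (r * column \<rho> r))"

definition op_G ::
  "real \<Rightarrow> real \<Rightarrow> (real ^ 3 \<Rightarrow> real) \<Rightarrow> (real ^ 3 \<Rightarrow> real) \<Rightarrow> (real ^ 3 \<Rightarrow> real) \<Rightarrow> real" where
  "op_G A \<epsilon> \<rho> \<sigma> \<tau> = op_L A \<rho> \<sigma> \<tau> + 6 * pi * \<epsilon>\<^sup>2 * op_T \<rho> \<sigma> \<tau>"

text \<open>The kernel of the form \<open>G\<close> restricted to \<open>R(B\<^sub>1)\<close> in both arguments.\<close>

definition reduced_kernel :: "real \<Rightarrow> real \<Rightarrow> (real ^ 3 \<Rightarrow> real) \<Rightarrow> (real ^ 3 \<Rightarrow> real) set" where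
  "reduced_kernel A \<epsilon> \<rho> = {\<sigma> \<in> RB1 A \<rho>. \<forall>\<tau>\<in>RB1 A \<rho>. op_G A \<epsilon> \<rho> \<sigma> \<tau> = 0}"


section \<open>The self-similar direction\<close>

definition rescaled :: "(real ^ 3 \<Rightarrow> real) \<Rightarrow> real \<Rightarrow> real ^ 3 \<Rightarrow> real" where
  "rescaled \<rho> l x = l ^ 3 * \<rho> (l *\<^sub>R x)"

definition self_similar_dir :: "(real ^ 3 \<Rightarrow> real) \<Rightarrow> real ^ 3 \<Rightarrow> real" where
  "self_similar_dir \<rho> x = deriv (\<lambda>l. rescaled \<rho> l x) 1"

end

theory Submission
  imports Defs
begin

text \<open>Put \<open>\<rho>\<^sub>l x = l\<^sup>3 \<rho> (l x)\<close>. Differentiating the equilibrium equation of \<open>\<rho>\<^sub>l\<close> at \<open>l = 1\<close> gives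
  \<open>\<Phi>''(\<rho>) f - |x|\<^sup>-\<^sup>1 * f + c = 3/2 \<epsilon>\<^sup>2 r\<^sup>2\<close> in the star, so \<open>\<langle>L f, \<tau>\<rangle> = 3/2 \<epsilon>\<^sup>2 \<integral> r\<^sup>2 \<tau>\<close> for \<open>\<integral> \<tau> = 0\<close>.
  Since the flux of \<open>\<rho>\<^sub>l\<close> at \<open>r\<close> is that of \<open>\<rho>\<close> at \<open>l r\<close>, the flux of \<open>f\<close> is \<open>r\<^sup>2 \<integral> \<rho>(r, z) dz\<close>, and
  interchanging integrals gives \<open>\<langle>T f, \<tau>\<rangle> = \<integral> r F\<^sub>\<tau>(r) dr = - 1/(4\<pi>) \<integral> r\<^sup>2 \<tau>\<close>; the two terms cancel.
  The regularity needed is that \<open>\<rho>\<close> is differentiable along rays: the Newtonian potential of a bounded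
  continuous density is, and \<open>\<rho>\<close> is a multiple of the cube of an affine function of that potential and \<open>r\<^sup>2\<close>, hence
  has vanishing derivative at the surface of the star.\<close>

section \<open>Integrals of radial functions\<close>

text \<open>Polar coordinates for radial integrands. Both measures give a half-line
  \<open>{..a}\<close> with \<open>a \<ge> 0\<close> the volume of the ball of radius
  \<open>a\<close>, the right one by the fundamental theorem of calculus, and half-lines generate
  the Borel sets. Used in dimension 3 for the Newtonian kernel and in dimension 2 for
  cylinders.\<close>

lemma distr_lborel_norm:
  "distr lborel borel (norm :: 'a::euclidean_space \<Rightarrow> real) =
     density lborel (\<lambda>s. ennreal (real DIM('a) * unit_ball_vol (real DIM('a)) * s ^ (DIM('a) - 1))
       * indicator {0..} s)" (is "?M = ?N")
proof (rule measure_eqI_generator_eq)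
  let ?n = "DIM('a)" and ?c = "unit_ball_vol (real DIM('a))"
  let ?E = "range (\<lambda>a::real. {..a})"
  show "Int_stable ?E" by (auto simp: Int_stable_def)
  show "?E \<subseteq> Pow UNIV" by simp
  show "sets ?M = sigma_sets UNIV ?E" "sets ?N = sigma_sets UNIV ?E"
    by (simp_all add: borel_eq_atMost)
  have M: "emeasure ?M {..a} = (if 0 \<le> a then ennreal (?c * a ^ ?n) else 0)" for a
  proof -
    have "emeasure ?M {..a} = emeasure lborel (norm -` {..a} :: 'a set)"
      by (subst emeasure_distr) auto
    also have "norm -` {..a} = (cball 0 a :: 'a set)" by auto
    finally show ?thesis by (auto simp: emeasure_cball)
  qed
  fix X assume "X \<in> ?E"
  then obtain a where X: "X = {..a}" by auto
  show "emeasure ?M X = emeasure ?N X"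
  proof (cases "0 \<le> a")
    case True
    have "emeasure ?N X = (\<integral>\<^sup>+ s. ennreal (real ?n * ?c * s ^ (?n - 1)) * indicator {0..a} s \<partial>lborel)"
      unfolding X by (subst emeasure_density) (auto intro!: nn_integral_cong split: split_indicator)
    also have "\<dots> = ?c * a ^ ?n - ?c * 0 ^ ?n"
      using True by (intro nn_integral_FTC_Icc)
        (auto intro!: derivative_eq_intros simp: zero_le_mult_iff)
    finally show ?thesis using True M[of a] X by simp
  next
    case False
    have "emeasure ?N X = (\<integral>\<^sup>+ s. ennreal (real ?n * ?c * s ^ (?n - 1)) * indicator {0..} s
        * indicator X s \<partial>lborel)"
      unfolding X by (rule emeasure_density) auto
    also have "\<dots> = (\<integral>\<^sup>+ s. 0 \<partial>(lborel :: real measure))"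
      using False X by (intro nn_integral_cong) (auto split: split_indicator)
    finally show ?thesis using False M[of a] X by simp
  qed
next
  show "range (\<lambda>i::nat. {..real i}) \<subseteq> range (\<lambda>a::real. {..a})" by auto
  show "(\<Union>i::nat. {..real i}) = UNIV" by (auto simp: real_arch_simple)
  fix i :: nat
  have "norm -` {..real i} = (cball 0 (real i) :: 'a set)" by auto
  then show "emeasure ?M {..real i} \<noteq> \<infinity>"
    by (subst emeasure_distr) (auto simp: emeasure_cball)
qed

text \<open>Needed for two substitutions: \<open>c = -1\<close> recentres a kernel at its
  singularity, and \<open>c = l\<close> undoes a dilation of the star.\<close>

lemma
  fixes g :: "'a::euclidean_space \<Rightarrow> real"
  assumes c: "c \<noteq> 0" and g: "g \<in> borel_measurable borel"
  shows integrable_lborel_affine_iff: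
      "integrable lborel (\<lambda>u. g (t + c *\<^sub>R u)) \<longleftrightarrow> integrable lborel g"
    and integral_lborel_affine:
      "\<bar>c\<bar> ^ DIM('a) * (LINT u|lborel. g (t + c *\<^sub>R u)) = (LINT u|lborel. g u)"
proof -
  let ?d = "distr lborel borel (\<lambda>u. t + c *\<^sub>R u :: 'a)"
  have eq: "lborel = density ?d (\<lambda>_. ennreal (\<bar>c\<bar> ^ DIM('a)))"
    using lborel_affine[OF c, of t] by simp
  have "integrable lborel g \<longleftrightarrow> integrable (density ?d (\<lambda>_. ennreal (\<bar>c\<bar> ^ DIM('a)))) g"
    using eq by simp
  also have "\<dots> \<longleftrightarrow> integrable ?d (\<lambda>u. \<bar>c\<bar> ^ DIM('a) *\<^sub>R g u)"
    using g by (intro integrable_density) auto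
  also have "\<dots> \<longleftrightarrow> integrable ?d g" using c by simp
  also have "\<dots> \<longleftrightarrow> integrable lborel (\<lambda>u. g (t + c *\<^sub>R u))"
    using g by (intro integrable_distr_eq) auto
  finally show "integrable lborel (\<lambda>u. g (t + c *\<^sub>R u)) \<longleftrightarrow> integrable lborel g" by simp
  have "(LINT u|lborel. g u) = integral\<^sup>L (density ?d (\<lambda>_. ennreal (\<bar>c\<bar> ^ DIM('a)))) g"
    using eq by simp
  also have "\<dots> = (LINT u|?d. \<bar>c\<bar> ^ DIM('a) *\<^sub>R g u)"
    using g by (intro integral_density) auto
  also have "\<dots> = \<bar>c\<bar> ^ DIM('a) * (LINT u|?d. g u)" by simp
  also have "(LINT u|?d. g u) = (LINT u|lborel. g (t + c *\<^sub>R u))"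
    using g by (intro integral_distr) auto
  finally show "\<bar>c\<bar> ^ DIM('a) * (LINT u|lborel. g (t + c *\<^sub>R u)) = (LINT u|lborel. g u)" by simp
qed

section \<open>Integral bounds for the Newtonian kernel and its gradient\<close>

text \<open>The Jacobian \<open>4 * pi * s\<^sup>2\<close> of polar coordinates cancels the
  singularity and leaves a constant integrand on \<open>{0..C}\<close>.\<close>

lemma has_bochner_integral_inverse_square_cball:
  assumes "0 \<le> C"
  shows "has_bochner_integral lborel
    (\<lambda>u::real^3. indicator (cball 0 C) u / (norm u)\<^sup>2) (4 * pi * C)"
proof (rule has_bochner_integral_nn_integral)
  have "(\<integral>\<^sup>+ u. ennreal (indicator (cball 0 C) u / (norm u)\<^sup>2) \<partial>(lborel :: (real^3) measure)) =
        (\<integral>\<^sup>+ u. ennreal (indicator {..C} (norm u) / (norm u)\<^sup>2) \<partial>(lborel :: (real^3) measure))"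
    by (intro nn_integral_cong) (auto split: split_indicator)
  also have "\<dots> = (\<integral>\<^sup>+ s. ennreal (indicator {..C} s / s\<^sup>2) \<partial>distr (lborel :: (real^3) measure) borel norm)"
    by (subst nn_integral_distr) auto
  also have "\<dots> = (\<integral>\<^sup>+ s. (ennreal (4 * pi * s\<^sup>2) * indicator {0..} s) *
      ennreal (indicator {..C} s / s\<^sup>2) \<partial>lborel)"
    unfolding distr_lborel_norm by (subst nn_integral_density) (auto simp: unit_ball_vol_3)
  also have "\<dots> = (\<integral>\<^sup>+ s. ennreal (4 * pi) * indicator {0..C} s \<partial>lborel)"
  proof (rule nn_integral_cong_AE)
    \<comment> \<open>The origin has to be excluded: since division by zero yields 0, the left
      integrand vanishes there while the right one is \<open>4 * pi\<close>.\<close>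
    have "AE s in lborel. s \<noteq> (0::real)" by (rule AE_lborel_singleton)
    then show "AE s in lborel. (ennreal (4 * pi * s\<^sup>2) * indicator {0..} s) *
      ennreal (indicator {..C} s / s\<^sup>2) = ennreal (4 * pi) * indicator {0..C} s"
      by eventually_elim (auto split: split_indicator simp: ennreal_mult[symmetric])
  qed
  also have "\<dots> = ennreal (4 * pi * C)"
    using assms by (simp add: nn_integral_cmult_indicator ennreal_mult[symmetric])
  finally show "(\<integral>\<^sup>+ u. ennreal (indicator (cball 0 C) u / (norm u)\<^sup>2) \<partial>(lborel :: (real^3) measure)) =
    ennreal (4 * pi * C)" .
qed (use assms in \<open>auto intro!: borel_measurable_divide borel_measurable_indicator\<close>)

text \<open>The substitution \<open>y = x - u\<close> moves the singularity to the origin, and the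
  shifted ball lies in the ball of radius \<open>norm x + C\<close> about the origin.\<close>

lemma
  fixes x :: "real^3"
  assumes "0 \<le> C"
  shows integrable_inverse_square: "integrable lborel (\<lambda>y. indicator (cball 0 C) y / (norm (x - y))\<^sup>2)"
    and integral_inverse_square_le:
      "(LINT y|lborel. indicator (cball 0 C) y / (norm (x - y))\<^sup>2) \<le> 4 * pi * (norm x + C)"
proof -
  let ?g = "\<lambda>y. indicator (cball 0 C) y / (norm (x - y))\<^sup>2 :: real"
  let ?h = "\<lambda>u::real^3. indicator (cball 0 (norm x + C)) u / (norm u)\<^sup>2 :: real"
  have h: "has_bochner_integral lborel ?h (4 * pi * (norm x + C))"
    using assms by (intro has_bochner_integral_inverse_square_cball) auto
  have g: "?g \<in> borel_measurable borel"
    by (intro borel_measurable_divide borel_measurable_indicator) simp_all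
  have le: "?g (x + (-1) *\<^sub>R u) \<le> ?h u" for u
  proof -
    have "norm u \<le> norm x + norm (x - u)" using norm_triangle_ineq4[of x "x - u"] by simp
    then show ?thesis by (auto split: split_indicator)
  qed
  have i: "integrable lborel (\<lambda>u. ?g (x + (-1) *\<^sub>R u))"
  proof (rule Bochner_Integration.integrable_bound)
    show "integrable lborel ?h" using h by (simp add: has_bochner_integral_iff)
    show "AE u in lborel. norm (?g (x + (-1) *\<^sub>R u)) \<le> norm (?h u)"
      using le by (intro AE_I2) (simp add: abs_mult)
  next
    have "(\<lambda>u::real^3. x + (-1) *\<^sub>R u) \<in> borel_measurable lborel" by simp
    with g show "(\<lambda>u. ?g (x + (-1) *\<^sub>R u)) \<in> borel_measurable lborel"
      using measurable_compose[of "\<lambda>u::real^3. x + (-1) *\<^sub>R u" lborel borel ?g borel] by blast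
  qed
  then show "integrable lborel ?g"
    using integrable_lborel_affine_iff[OF _ g, of "-1" x] by linarith
  have "(LINT y|lborel. ?g y) = (LINT u|lborel. ?g (x + (-1) *\<^sub>R u))"
    using integral_lborel_affine[OF _ g, of "-1" x] by simp
  also have "\<dots> \<le> (LINT u|lborel. ?h u)"
    using i le h by (intro integral_mono) (auto simp: has_bochner_integral_iff)
  finally show "(LINT y|lborel. ?g y) \<le> 4 * pi * (norm x + C)"
    using h by (simp add: has_bochner_integral_iff)
qed

text \<open>Makes the inverse square kernel dominate the potential as well as its radial derivative.
  For \<open>x = y\<close> both sides are 0 by the convention for division.\<close>

lemma inverse_le_square:
  fixes x y :: "'a::real_normed_vector"
  assumes "norm y \<le> C"
  shows "1 / norm (x - y) \<le> (norm x + C) / (norm (x - y))\<^sup>2"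
proof (cases "x = y")
  case False
  have "norm (x - y) \<le> norm x + C" using norm_triangle_ineq4[of x y] assms by linarith
  then show ?thesis using False by (simp add: field_simps power2_eq_square)
qed simp

text \<open>Stated for measurable densities without continuity, because it is applied to the
  self-similar direction and to the indicator of a ball as well.\<close>

lemma
  fixes x :: "real^3" and q :: "real^3 \<Rightarrow> real"
  assumes q [measurable]: "q \<in> borel_measurable borel"
    and M: "\<And>y. \<bar>q y\<bar> \<le> M" and C: "\<And>y. q y \<noteq> 0 \<Longrightarrow> norm y \<le> C" "0 \<le> C"
  shows integrable_newton: "integrable lborel (\<lambda>y. q y / norm (x - y))"
    and abs_newton_le: "(LINT y|lborel. \<bar>q y\<bar> / norm (x - y)) \<le> 4 * pi * M * (norm x + C)\<^sup>2"
proof -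
  let ?h = "\<lambda>y. M * (norm x + C) * (indicator (cball 0 C) y / (norm (x - y))\<^sup>2)"
  have M0: "0 \<le> M" using M[of 0] by linarith
  have hi: "integrable lborel ?h"
    using integrable_inverse_square[OF C(2)] by (rule integrable_mult_right)
  have le: "\<bar>q y\<bar> / norm (x - y) \<le> ?h y" for y
  proof (cases "q y = 0")
    case False
    have "\<bar>q y\<bar> / norm (x - y) \<le> M * (1 / norm (x - y))"
      using M[of y] by (simp add: divide_right_mono)
    also have "\<dots> \<le> M * ((norm x + C) / (norm (x - y))\<^sup>2)"
      using C(1)[OF False] M0 by (intro mult_left_mono inverse_le_square) auto
    finally show ?thesis using C(1)[OF False] by (simp add: indicator_def)
  qed (use M0 C in \<open>auto simp: indicator_def\<close>)
  show "integrable lborel (\<lambda>y. q y / norm (x - y))"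
  proof (rule Bochner_Integration.integrable_bound[OF hi])
    show "AE y in lborel. norm (q y / norm (x - y)) \<le> norm (?h y)"
    proof (rule AE_I2)
      fix y
      have "norm (q y / norm (x - y)) = \<bar>q y\<bar> / norm (x - y)" by simp
      also have "\<dots> \<le> norm (?h y)" 
        unfolding real_norm_def using order_trans[OF le[of y] abs_ge_self] .
      finally show "norm (q y / norm (x - y)) \<le> norm (?h y)" .
    qed
  qed measurable
  then have "(LINT y|lborel. \<bar>q y\<bar> / norm (x - y)) \<le> (LINT y|lborel. ?h y)"
    using le hi by (intro integral_mono) (auto dest: integrable_abs)
  also have "\<dots> = M * (norm x + C) * (LINT y|lborel. indicator (cball 0 C) y / (norm (x - y))\<^sup>2)"
    by (rule integral_mult_right_zero)
  also have "\<dots> \<le> M * (norm x + C) * (4 * pi * (norm x + C))"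
    using M0 C(2) integral_inverse_square_le[OF C(2)] by (intro mult_left_mono) auto
  finally show "(LINT y|lborel. \<bar>q y\<bar> / norm (x - y)) \<le> 4 * pi * M * (norm x + C)\<^sup>2"
    by (simp add: power2_eq_square algebra_simps)
qed

section \<open>Cylindrical coordinates\<close>

lemma cyl_point_nth [simp]:
  "cyl_point r z $ 1 = r" "cyl_point r z $ 2 = 0" "cyl_point r z $ 3 = z"
  by (simp_all add: cyl_point_def)

lemma continuous_on_cyl_radius [continuous_intros]:
  "continuous_on S f \<Longrightarrow> continuous_on S (\<lambda>x. cyl_radius (f x))"
  unfolding cyl_radius_def by (intro continuous_intros)

lemma borel_measurable_cyl_radius [measurable]: "cyl_radius \<in> borel_measurable borel"
  by (intro borel_measurable_continuous_onI continuous_intros)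

lemma cyl_radius_nonneg [simp]: "0 \<le> cyl_radius x"
  by (simp add: cyl_radius_def)

lemma cyl_radius_scaleR: "cyl_radius (t *\<^sub>R x) = \<bar>t\<bar> * cyl_radius x"
proof -
  have "(t * x $ 1)\<^sup>2 + (t * x $ 2)\<^sup>2 = t\<^sup>2 * ((x $ 1)\<^sup>2 + (x $ 2)\<^sup>2)" by algebra
  then show ?thesis by (simp add: cyl_radius_def real_sqrt_mult)
qed

lemma cyl_radius_cyl_point: "0 \<le> r \<Longrightarrow> cyl_radius (cyl_point r z) = r"
  by (simp add: cyl_radius_def)

lemma norm_eq_cyl_radius: "(norm x)\<^sup>2 = (cyl_radius x)\<^sup>2 + (x $ 3)\<^sup>2"
  by (simp add: norm_vec_def L2_set_def sum_3 cyl_radius_def)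

lemma cyl_radius_le_norm: "cyl_radius x \<le> norm x"
  by (rule power2_le_imp_le) (simp_all add: norm_eq_cyl_radius)

lemma axisymmetric_cyl_point: "axisymmetric g \<Longrightarrow> g (cyl_point (cyl_radius x) (x $ 3)) = g x"
  unfolding axisymmetric_def by (metis cyl_point_nth(3) cyl_radius_cyl_point cyl_radius_nonneg)

lemma cyl_point_eq_axis: "cyl_point r z = r *\<^sub>R axis 1 1 + z *\<^sub>R axis 3 1"
  by (simp add: vec_eq_iff forall_3 axis_def)

lemma continuous_on_cyl_point [continuous_intros]:
  "continuous_on S f \<Longrightarrow> continuous_on S g \<Longrightarrow> continuous_on S (\<lambda>x. cyl_point (f x) (g x))"
  unfolding cyl_point_eq_axis by (intro continuous_intros)

section \<open>Space as the product of the horizontal plane and the axis of rotation\<close>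

text \<open>The pairs are nested so that the first component is the horizontal position, whose norm
  in \<open>real \<times> real\<close> is the cylindrical radius; planar polar coordinates then
  apply to it directly.\<close>

definition vec3_of_prod :: "(real \<times> real) \<times> real \<Rightarrow> real ^ 3" where
  "vec3_of_prod p = fst (fst p) *\<^sub>R axis 1 1 + snd (fst p) *\<^sub>R axis 2 1 + snd p *\<^sub>R axis 3 1"

lemma vec3_of_prod_nth [simp]:
  "vec3_of_prod p $ 1 = fst (fst p)" "vec3_of_prod p $ 2 = snd (fst p)" "vec3_of_prod p $ 3 = snd p"
  by (simp_all add: vec3_of_prod_def axis_def)

lemma borel_measurable_vec3_of_prod [measurable]: "vec3_of_prod \<in> borel_measurable borel"
  unfolding vec3_of_prod_def by (intro borel_measurable_continuous_onI continuous_intros)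

text \<open>Lebesgue measure is determined by its values on open boxes, and the preimage of a box is
  a product of three intervals.\<close>

lemma distr_vec3_of_prod: "distr lborel borel vec3_of_prod = lborel"
proof (rule lborel_eqI[symmetric])
  fix l u :: "real ^ 3"
  assume lu: "\<And>b. b \<in> Basis \<Longrightarrow> l \<bullet> b \<le> u \<bullet> b"
  have le: "l $ i \<le> u $ i" for i
    using lu[of "axis i 1"] by (simp add: axis_in_Basis_iff inner_axis)
  have pre: "vec3_of_prod -` box l u =
      ({l $ 1<..<u $ 1} \<times> {l $ 2<..<u $ 2}) \<times> {l $ 3<..<u $ 3}"
    by (auto simp: mem_box_cart forall_3)
  have "emeasure (distr lborel borel vec3_of_prod) (box l u) =
      emeasure lborel (({l $ 1<..<u $ 1} \<times> {l $ 2<..<u $ 2}) \<times> {l $ 3<..<u $ 3})"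
    by (subst emeasure_distr) (simp_all add: pre)
  also have "\<dots> = ennreal (u $ 1 - l $ 1) * ennreal (u $ 2 - l $ 2) * ennreal (u $ 3 - l $ 3)"
    using le unfolding lborel_prod[symmetric]
    by (simp add: lborel.emeasure_pair_measure_Times)
  also have "\<dots> = ennreal (\<Prod>b\<in>Basis. (u - l) \<bullet> b)"
  proof -
    have "(\<Prod>b\<in>Basis. (u - l) \<bullet> b) = (\<Prod>i\<in>UNIV. u $ i - l $ i)"
      unfolding Basis_vec_def
      by (simp add: UNION_singleton_eq_range, subst prod.reindex)
         (auto simp: inj_on_def axis_eq_axis inner_axis)
    also have "\<dots> = (u $ 1 - l $ 1) * (u $ 2 - l $ 2) * (u $ 3 - l $ 3)"
      unfolding UNIV_3 by (simp add: ac_simps)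
    finally show ?thesis
      using le[of 1] le[of 2] le[of 3] by (simp add: ennreal_mult)
  qed
  finally show "emeasure (distr lborel borel vec3_of_prod) (box l u) =
    ennreal (\<Prod>b\<in>Basis. (u - l) \<bullet> b)" .
qed simp

lemma borel_measurable_column [measurable]:
  assumes [measurable]: "g \<in> borel_measurable borel"
  shows "column g \<in> borel_measurable borel"
proof -
  have "(\<lambda>p. cyl_point (fst p) (snd p)) \<in> borel_measurable borel"
    by (intro borel_measurable_continuous_onI continuous_intros)
  then have [measurable]: "(\<lambda>p. cyl_point (fst p) (snd p)) \<in> borel_measurable (borel \<Otimes>\<^sub>M borel)"
    by (simp add: borel_prod)
  show ?thesis unfolding column_def[abs_def] by measurable
qed

text \<open>Integrating out the height first leaves, by axial symmetry, a function of
  \<open>norm p\<close> alone, and planar polar coordinates supply the weight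
  \<open>2 * pi * s\<close>. This turns fluxes into volume integrals, to which dilations and Fubini
  apply.\<close>

lemma integral_cylinder_eq_flux:
  assumes g: "integrable lborel g" and [measurable]: "g \<in> borel_measurable borel"
    and ax: "axisymmetric g"
  shows "(LINT x|lborel. indicator {..r} (cyl_radius x) * g x) = 2 * pi * flux g r"
proof -
  define h where "h x = indicator {..r} (cyl_radius x) * g x" for x
  have [measurable]: "h \<in> borel_measurable borel" unfolding h_def[abs_def] by measurable
  have hi: "integrable lborel h"
    by (rule Bochner_Integration.integrable_bound[OF g]) (auto simp: h_def indicator_def)
  have h_vec3: "h (vec3_of_prod (p, z)) = indicator {..r} (norm p) * g (cyl_point (norm p) z)" for p z
  proof -
    have "cyl_radius (vec3_of_prod (p, z)) = norm p"
      by (simp add: cyl_radius_def norm_prod_def)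
    then show ?thesis
      using axisymmetric_cyl_point[OF ax, of "vec3_of_prod (p, z)"] by (simp add: h_def)
  qed
  have "(LINT x|lborel. h x) = (LINT x|distr lborel borel vec3_of_prod. h x)"
    by (simp add: distr_vec3_of_prod)
  also have "\<dots> = (LINT p|lborel. h (vec3_of_prod p))"
    by (rule integral_distr) auto
  also have "\<dots> = (LINT p|(lborel \<Otimes>\<^sub>M lborel). h (vec3_of_prod p))"
    by (simp add: lborel_prod)
  also have "\<dots> = (LINT p|lborel. LINT z|lborel. h (vec3_of_prod (p, z)))"
  proof (rule lborel_pair.integral_fst'[symmetric])
    have "integrable (distr lborel borel vec3_of_prod) h"
      using hi by (simp add: distr_vec3_of_prod)
    then show "integrable (lborel \<Otimes>\<^sub>M lborel) (\<lambda>p. h (vec3_of_prod p))"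
      by (simp add: lborel_prod integrable_distr_eq)
  qed
  also have "\<dots> = (LINT p|lborel. indicator {..r} (norm (p::real \<times> real)) * column g (norm p))"
    by (simp add: h_vec3 column_def)
  also have "\<dots> = (LINT s|distr lborel borel (norm :: real \<times> real \<Rightarrow> real). indicator {..r} s * column g s)"
    by (rule integral_distr[symmetric]) auto
  also have "distr lborel borel (norm :: real \<times> real \<Rightarrow> real) =
      density lborel (\<lambda>s. ennreal (2 * pi * s * indicator {0..} s))"
    unfolding distr_lborel_norm
    by (intro density_cong) (auto simp: unit_ball_vol_2 split: split_indicator)
  also have "(LINT s|\<dots>. indicator {..r} s * column g s) =
      (LINT s|lborel. (2 * pi * s * indicator {0..} s) *\<^sub>R (indicator {..r} s * column g s))"
    by (rule integral_density) (auto split: split_indicator)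
  also have "\<dots> = (LINT s|lborel. 2 * pi * (indicator {0..r} s * (s * column g s)))"
    by (intro Bochner_Integration.integral_cong) (auto split: split_indicator)
  also have "\<dots> = 2 * pi * flux g r"
    by (simp add: flux_def set_lebesgue_integral_def)
  finally show ?thesis by (simp add: h_def)
qed

section \<open>The Newtonian potential along rays\<close>

text \<open>The negative of \<open>potential\<close>, so that the kernel is positive.\<close>

definition newton :: "(real ^ 3 \<Rightarrow> real) \<Rightarrow> real ^ 3 \<Rightarrow> real" where
  "newton q x = (LINT y|lborel. q y / norm (x - y))"

text \<open>The derivative of \<open>newton q (s *\<^sub>R x)\<close> at \<open>s = 1\<close>, that
  is, the gradient of the potential paired with \<open>x\<close> itself and not with the unit
  vector.\<close>

definition newton_radial :: "(real ^ 3 \<Rightarrow> real) \<Rightarrow> real ^ 3 \<Rightarrow> real" where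
  "newton_radial q x = (LINT y|lborel. q y * (- ((x - y) \<bullet> x) / norm (x - y) ^ 3))"

lemma inner_div_norm_cube_le:
  fixes v w :: "'a::real_inner"
  shows "\<bar>- (v \<bullet> w) / norm v ^ 3\<bar> \<le> norm w / (norm v)\<^sup>2"
proof (cases "v = 0")
  case False
  have "\<bar>v \<bullet> w\<bar> / norm v ^ 3 \<le> (norm v * norm w) / norm v ^ 3"
    by (intro divide_right_mono Cauchy_Schwarz_ineq2) simp
  then show ?thesis using False by (simp add: power2_eq_square power3_eq_cube)
qed simp

lemma has_real_derivative_inverse_norm:
  fixes x y :: "'a::real_inner"
  assumes "s *\<^sub>R x \<noteq> y"
  shows "((\<lambda>s. 1 / norm (s *\<^sub>R x - y)) has_real_derivative
     (- ((s *\<^sub>R x - y) \<bullet> x) / norm (s *\<^sub>R x - y) ^ 3)) (at s)"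
proof -
  let ?p = "\<lambda>s. (s *\<^sub>R x - y) \<bullet> (s *\<^sub>R x - y)"
  have pe: "?p s = s\<^sup>2 * (x \<bullet> x) - 2 * s * (x \<bullet> y) + y \<bullet> y" for s
    by (simp add: algebra_simps inner_commute power2_eq_square)
  have p: "(?p has_real_derivative 2 * ((s *\<^sub>R x - y) \<bullet> x)) (at s)"
    unfolding pe by (auto intro!: derivative_eq_intros simp: algebra_simps inner_commute)
  have pos: "0 < ?p s" using assms by simp
  have "((\<lambda>s. 1 / sqrt (?p s)) has_real_derivative
      - ((s *\<^sub>R x - y) \<bullet> x) / (sqrt (?p s)) ^ 3) (at s)"
    using pos
    by (auto intro!: derivative_eq_intros p simp del: inner_gt_zero_iff
        simp: field_simps power2_eq_square power3_eq_cube)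
  then show ?thesis by (simp add: norm_eq_sqrt_inner)
qed


section \<open>Potentials of continuous bounded densities with bounded support\<close>

locale bounded_density =
  fixes q :: "real ^ 3 \<Rightarrow> real" and M C :: real
  assumes continuous: "continuous_on UNIV q"
    and abs_le: "\<bar>q y\<bar> \<le> M"
    and support: "q y \<noteq> 0 \<Longrightarrow> norm y \<le> C"
    and C_nonneg: "0 \<le> C"
begin

lemma measurable_density [measurable]: "q \<in> borel_measurable borel"
  using continuous by (rule borel_measurable_continuous_onI)

lemma M_nonneg: "0 \<le> M"
  using abs_le[of 0] by linarith

lemma kernel_le:
  "\<bar>q y * (- (v \<bullet> x) / norm v ^ 3)\<bar> \<le> M * norm x * (indicator (cball 0 C) y / (norm v)\<^sup>2)"
proof (cases "q y = 0")
  case False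
  have "\<bar>q y\<bar> * \<bar>- (v \<bullet> x) / norm v ^ 3\<bar> \<le> M * (norm x / (norm v)\<^sup>2)"
    using abs_le M_nonneg by (intro mult_mono inner_div_norm_cube_le) auto
  then show ?thesis using support[OF False] by (simp add: abs_mult)
qed (use M_nonneg in auto)

lemma
  shows integrable_radial_kernel: "integrable lborel (\<lambda>y. q y * (- ((s *\<^sub>R x - y) \<bullet> x) / norm (s *\<^sub>R x - y) ^ 3))"
    and abs_radial_kernel_le:
      "(LINT y|lborel. \<bar>q y * (- ((s *\<^sub>R x - y) \<bullet> x) / norm (s *\<^sub>R x - y) ^ 3)\<bar>)
        \<le> 4 * pi * M * norm x * (\<bar>s\<bar> * norm x + C)"
proof -
  let ?f = "\<lambda>y. q y * (- ((s *\<^sub>R x - y) \<bullet> x) / norm (s *\<^sub>R x - y) ^ 3)"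
  let ?h = "\<lambda>y. M * norm x * (indicator (cball 0 C) y / (norm (s *\<^sub>R x - y))\<^sup>2)"
  have h: "integrable lborel ?h"
    using integrable_inverse_square[OF C_nonneg] by (rule integrable_mult_right)
  show f: "integrable lborel ?f"
  proof (rule Bochner_Integration.integrable_bound[OF h])
    show "AE y in lborel. norm (?f y) \<le> norm (?h y)"
      unfolding real_norm_def by (intro AE_I2 order_trans[OF kernel_le abs_ge_self])
  qed measurable
  have "(LINT y|lborel. \<bar>?f y\<bar>) \<le> (LINT y|lborel. ?h y)"
    by (intro integral_mono integrable_abs f h kernel_le)
  also have "\<dots> = M * norm x * (LINT y|lborel. indicator (cball 0 C) y / (norm (s *\<^sub>R x - y))\<^sup>2)"
    by (rule integral_mult_right_zero)
  also have "\<dots> \<le> M * norm x * (4 * pi * (norm (s *\<^sub>R x) + C))"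
    using M_nonneg by (intro mult_left_mono integral_inverse_square_le[OF C_nonneg]) auto
  finally show "(LINT y|lborel. \<bar>?f y\<bar>) \<le> 4 * pi * M * norm x * (\<bar>s\<bar> * norm x + C)"
    by (simp add: algebra_simps)
qed

lemma abs_newton_radial_le: "\<bar>newton_radial q x\<bar> \<le> 4 * pi * M * norm x * (norm x + C)"
proof -
  have "\<bar>newton_radial q x\<bar> \<le> (LINT y|lborel. \<bar>q y * (- ((x - y) \<bullet> x) / norm (x - y) ^ 3)\<bar>)"
    unfolding newton_radial_def by (rule integral_abs_bound)
  also have "\<dots> \<le> 4 * pi * M * norm x * (norm x + C)"
    using abs_radial_kernel_le[of 1 x] by simp
  finally show ?thesis .
qed

text \<open>In the variable \<open>u = s *\<^sub>R x - y\<close> the singularity stays at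
  \<open>u = 0\<close> and \<open>s\<close> enters only through the continuous factor
  \<open>q\<close>, so dominated convergence applies. For \<open>s\<close> in \<open>{0..2}\<close>
  all relevant \<open>u\<close> lie in the ball of radius \<open>2 * norm x + C\<close>.\<close>

lemma continuous_on_radial_kernel:
  "continuous_on {0..2} (\<lambda>s. LINT y|lborel. q y * (- ((s *\<^sub>R x - y) \<bullet> x) / norm (s *\<^sub>R x - y) ^ 3))"
proof -
  let ?k = "\<lambda>s u. q (s *\<^sub>R x - u) * (- (u \<bullet> x) / norm u ^ 3)"
  let ?h = "\<lambda>u::real^3. M * norm x * (indicator (cball 0 (2 * norm x + C)) u / (norm u)\<^sup>2)"
  have shift: "(LINT y|lborel. q y * (- ((s *\<^sub>R x - y) \<bullet> x) / norm (s *\<^sub>R x - y) ^ 3)) =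
      (LINT u|lborel. ?k s u)" for s
    using integral_lborel_affine[of "-1" "\<lambda>y. q y * (- ((s *\<^sub>R x - y) \<bullet> x) / norm (s *\<^sub>R x - y) ^ 3)" "s *\<^sub>R x"]
    by simp
  have bound: "\<bar>?k s u\<bar> \<le> ?h u" if "s \<in> {0..2}" for s u
  proof (cases "q (s *\<^sub>R x - u) = 0")
    case False
    have "norm u \<le> norm (s *\<^sub>R x) + norm (s *\<^sub>R x - u)"
      using norm_triangle_ineq4[of "s *\<^sub>R x" "s *\<^sub>R x - u"] by simp
    also have "\<dots> \<le> 2 * norm x + C"
      using that support[OF False] by (intro add_mono) (auto intro: mult_right_mono)
    finally have u: "norm u \<le> 2 * norm x + C" .
    have "\<bar>q (s *\<^sub>R x - u)\<bar> * \<bar>- (u \<bullet> x) / norm u ^ 3\<bar> \<le> M * (norm x / (norm u)\<^sup>2)"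
      using abs_le M_nonneg by (intro mult_mono inner_div_norm_cube_le) auto
    then show ?thesis using u by (simp add: abs_mult)
  qed (use M_nonneg in auto)
  show ?thesis
    unfolding shift
  proof (rule continuous_on_sequentiallyI)
    fix t :: "nat \<Rightarrow> real" and a
    assume t: "\<forall>n. t n \<in> {0..2}" and lim: "t \<longlonglongrightarrow> a"
    show "(\<lambda>n. LINT u|lborel. ?k (t n) u) \<longlonglongrightarrow> (LINT u|lborel. ?k a u)"
    proof (rule integral_dominated_convergence[where w = ?h])
      have h: "has_bochner_integral lborel (\<lambda>u::real^3. indicator (cball 0 (2 * norm x + C)) u / (norm u)\<^sup>2)
          (4 * pi * (2 * norm x + C))"
        using C_nonneg by (intro has_bochner_integral_inverse_square_cball) auto
      show "integrable lborel ?h"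
        by (intro integrable_mult_right integrable.intros[OF h])
      show "AE u in lborel. (\<lambda>n. ?k (t n) u) \<longlonglongrightarrow> ?k a u"
      proof (rule AE_I2)
        fix u
        have "continuous_on UNIV (\<lambda>s. q (s *\<^sub>R x - u))"
          by (rule continuous_on_compose2[OF continuous]) (auto intro!: continuous_intros)
        then have "isCont (\<lambda>s. q (s *\<^sub>R x - u)) a"
          by (simp add: continuous_on_eq_continuous_at)
        then show "(\<lambda>n. ?k (t n) u) \<longlonglongrightarrow> ?k a u"
          by (intro tendsto_mult tendsto_const isCont_tendsto_compose[OF _ lim])
      qed
      show "AE u in lborel. norm (?k (t n) u) \<le> ?h u" for n
        using t by (intro AE_I2) (simp only: real_norm_def bound)
    qed measurable
  qed
qed

text \<open>The singular kernel is not differentiable under the integral sign by domination; instead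
  the fundamental theorem of calculus is applied along the ray for fixed \<open>y\<close> off its line, and
  the integrals are interchanged.\<close>

lemma newton_diff_eq_integral:
  assumes b: "0 \<le> b" "b \<le> 2"
  shows "newton q (b *\<^sub>R x) - newton q 0 =
    integral {0..b} (\<lambda>s. LINT y|lborel. q y * (- ((s *\<^sub>R x - y) \<bullet> x) / norm (s *\<^sub>R x - y) ^ 3))"
proof -
  let ?k = "\<lambda>s y. q y * (- ((s *\<^sub>R x - y) \<bullet> x) / norm (s *\<^sub>R x - y) ^ 3)"
  let ?W = "\<lambda>s. LINT y|lborel. ?k s y"
  let ?F = "\<lambda>s y. indicator {0..b} s * ?k s y"
  have F: "integrable (lborel \<Otimes>\<^sub>M lborel) (case_prod ?F)"
  proof (rule lborel_pair.Fubini_integrable)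
    show "case_prod ?F \<in> borel_measurable (lborel \<Otimes>\<^sub>M lborel)"
      by measurable
    let ?c = "4 * pi * M * norm x * (2 * norm x + C)"
    show "integrable lborel (\<lambda>s. LINT y|lborel. norm (case_prod ?F (s, y)))"
    proof (rule Bochner_Integration.integrable_bound)
      show "integrable lborel (\<lambda>s. indicator {0..b} s * ?c)"
        using b by (intro integrable_mult_left integrable_real_indicator) auto
      show "AE s in lborel. norm (LINT y|lborel. norm (case_prod ?F (s, y))) \<le> norm (indicator {0..b} s * ?c)"
      proof (rule AE_I2)
        fix s
        show "norm (LINT y|lborel. norm (case_prod ?F (s, y))) \<le> norm (indicator {0..b} s * ?c)"
        proof (cases "s \<in> {0..b}")
          case True
          have "(LINT y|lborel. \<bar>?k s y\<bar>) \<le> 4 * pi * M * norm x * (\<bar>s\<bar> * norm x + C)"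
            by (rule abs_radial_kernel_le)
          also have "\<dots> \<le> ?c"
            using True b M_nonneg by (intro mult_left_mono add_right_mono mult_right_mono) auto
          finally have "(LINT y|lborel. \<bar>?k s y\<bar>) \<le> ?c" .
          moreover have "0 \<le> (LINT y|lborel. \<bar>?k s y\<bar>)" by simp
          ultimately show ?thesis using True by simp
        qed simp
      qed
    qed measurable
    show "AE s in lborel. integrable lborel (\<lambda>y. case_prod ?F (s, y))"
      using integrable_radial_kernel by (intro AE_I2) (simp del: times_divide_eq_right)
  qed
  have "newton q (b *\<^sub>R x) - newton q 0 = (LINT y|lborel. q y / norm (b *\<^sub>R x - y) - q y / norm (0 - y))"
    unfolding newton_def
    by (intro Bochner_Integration.integral_diff[symmetric] integrable_newton[OF _ abs_le support C_nonneg])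
      auto
  also have "\<dots> = (LINT y|lborel. LINT s|lborel. ?F s y)"
  proof (rule integral_cong_AE)
    \<comment> \<open>The line spanned by \<open>x\<close> is a subspace of dimension at most 1 in
      three-dimensional space, hence a null set; for \<open>y\<close> off it the integrand in
      \<open>s\<close> has no singularity.\<close>
    have "dim (span {x}) \<le> card {x}" unfolding dim_span by (rule dim_le_card') simp
    then have "negligible (span {x})" by (intro negligible_lowdim) simp
    then have "AE y in lebesgue. y \<notin> span {x}"
      by (simp add: negligible_iff_null_sets AE_not_in)
    then have "AE y in lborel. y \<notin> span {x}" by (simp add: AE_completion_iff)
    then show "AE y in lborel. q y / norm (b *\<^sub>R x - y) - q y / norm (0 - y) = (LINT s|lborel. ?F s y)"
    proof eventually_elim
      fix y assume "y \<notin> span {x}"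
      then have ne: "s *\<^sub>R x \<noteq> y" for s by (auto simp: span_singleton)
      have "(LINT s|lborel. indicator {0..b} s *\<^sub>R (- ((s *\<^sub>R x - y) \<bullet> x) / norm (s *\<^sub>R x - y) ^ 3)) =
          1 / norm (b *\<^sub>R x - y) - 1 / norm (0 *\<^sub>R x - y)"
      proof (rule integral_FTC_Icc[OF b(1)])
        show "((\<lambda>s. 1 / norm (s *\<^sub>R x - y)) has_vector_derivative
            - ((s *\<^sub>R x - y) \<bullet> x) / norm (s *\<^sub>R x - y) ^ 3) (at s within {0..b})" for s
          using has_real_derivative_inverse_norm[OF ne, of s]
          unfolding has_real_derivative_iff_has_vector_derivative
          by (rule has_vector_derivative_at_within)
        show "continuous_on {0..b} (\<lambda>s. - ((s *\<^sub>R x - y) \<bullet> x) / norm (s *\<^sub>R x - y) ^ 3)"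
          using ne by (intro continuous_intros) auto
      qed
      then have "q y * (LINT s|lborel. indicator {0..b} s *\<^sub>R (- ((s *\<^sub>R x - y) \<bullet> x) / norm (s *\<^sub>R x - y) ^ 3)) =
          q y / norm (b *\<^sub>R x - y) - q y / norm (0 - y)"
        by (simp only: right_diff_distrib times_divide_eq_right mult_1_right scaleR_zero_left)
      moreover have "q y * (LINT s|lborel. indicator {0..b} s *\<^sub>R (- ((s *\<^sub>R x - y) \<bullet> x) / norm (s *\<^sub>R x - y) ^ 3)) =
          (LINT s|lborel. ?F s y)"
        unfolding integral_mult_right_zero[symmetric]
        by (intro Bochner_Integration.integral_cong) (simp_all only: real_scaleR_def ac_simps)
      ultimately show "q y / norm (b *\<^sub>R x - y) - q y / norm (0 - y) = (LINT s|lborel. ?F s y)" by simp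
    qed
  qed measurable
  also have "\<dots> = (LINT s|lborel. LINT y|lborel. ?F s y)"
    by (rule lborel_pair.Fubini_integral[OF F])
  also have "\<dots> = (LINT s:{0..b}|lborel. ?W s)"
    unfolding set_lebesgue_integral_def real_scaleR_def integral_mult_right_zero ..
  also have "\<dots> = integral {0..b} ?W"
  proof (rule set_borel_integral_eq_integral)
    show "set_integrable lborel {0..b} ?W"
      using continuous_on_subset[OF continuous_on_radial_kernel] b
      by (intro borel_integrable_atLeastAtMost') auto
  qed
  finally show ?thesis .
qed

text \<open>The increment along the ray is the integral of a continuous function of
  \<open>s\<close>, and 1 is an interior point of \<open>{0..2}\<close>, so the one-sided notion of
  derivative there is the full one.\<close>

lemma newton_has_radial_derivative:
  "((\<lambda>s. newton q (s *\<^sub>R x)) has_real_derivative newton_radial q x) (at 1)"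
proof -
  let ?W = "\<lambda>s. LINT y|lborel. q y * (- ((s *\<^sub>R x - y) \<bullet> x) / norm (s *\<^sub>R x - y) ^ 3)"
  have "((\<lambda>b. newton q 0 + integral {0..b} ?W) has_real_derivative 0 + ?W 1) (at 1 within {0..2})"
    by (intro DERIV_add DERIV_const integral_has_real_derivative continuous_on_radial_kernel) simp
  then have "((\<lambda>b. newton q (b *\<^sub>R x)) has_real_derivative 0 + ?W 1) (at 1 within {0..2})"
  proof (rule has_field_derivative_transform_within[of _ _ _ _ 1])
    fix b :: real assume "b \<in> {0..2}"
    then show "newton q 0 + integral {0..b} ?W = newton q (b *\<^sub>R x)"
      using newton_diff_eq_integral[of b x] by simp
  qed auto
  moreover have "at (1::real) within {0..2} = at 1"
    by (rule at_within_interior) simp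
  ultimately show ?thesis by (simp add: newton_radial_def)
qed

end

section \<open>Differentiability of the star along rays\<close>

text \<open>The difference quotients of \<open>h\<close> are dominated by those of \<open>p\<close>.
  This handles surface points of the star, where only one side of the ray lies inside.\<close>

lemma has_real_derivative_zero_squeeze:
  fixes h p :: "real \<Rightarrow> real"
  assumes p: "(p has_real_derivative 0) (at a)" "p a = 0" and h: "h a = 0"
    and le: "eventually (\<lambda>s. \<bar>h s\<bar> \<le> \<bar>p s\<bar>) (at a)"
  shows "(h has_real_derivative 0) (at a)"
proof -
  have "((\<lambda>s. (p s - p a) / (s - a)) \<longlongrightarrow> 0) (at a)"
    using p(1) by (simp add: has_field_derivative_iff)
  moreover have "eventually (\<lambda>s. norm ((h s - h a) / (s - a)) \<le> norm ((p s - p a) / (s - a)) * 1) (at a)"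
    using le by eventually_elim (simp add: p(2) h divide_right_mono)
  ultimately have "((\<lambda>s. (h s - h a) / (s - a)) \<longlongrightarrow> 0) (at a)"
    by (rule tendsto_0_le)
  then show ?thesis by (simp add: has_field_derivative_iff)
qed

section \<open>Vertical integrals of a density\<close>

context bounded_density
begin

lemma abs_cyl_point_le: "\<bar>q (cyl_point r z)\<bar> \<le> indicator {-C..C} z * M"
proof (cases "q (cyl_point r z) = 0")
  case False
  have "\<bar>cyl_point r z $ 3\<bar> \<le> norm (cyl_point r z)"
    by (rule component_le_norm_cart)
  then have "z \<in> {-C..C}" using support[OF False] by auto
  then show ?thesis using abs_le by simp
qed (use M_nonneg in auto)

lemma integrable_indicator_Icc_mult: "integrable lborel (\<lambda>z. indicator {-C..C} z * M)"
proof -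
  have "emeasure lborel {-C..C} < top"
    by (simp add: emeasure_lborel_Icc_eq)
  then show ?thesis by (intro integrable_mult_left integrable_real_indicator) auto
qed

lemma continuous_on_cyl_point_density:
  shows "continuous_on UNIV (\<lambda>r. q (cyl_point r z))" "continuous_on UNIV (\<lambda>z. q (cyl_point r z))"
  by (rule continuous_on_compose2[OF continuous]; auto intro!: continuous_intros)+

lemma integrable_cyl_point: "integrable lborel (\<lambda>z. q (cyl_point r z))"
proof (rule Bochner_Integration.integrable_bound[OF integrable_indicator_Icc_mult])
  show "(\<lambda>z. q (cyl_point r z)) \<in> borel_measurable lborel"
    using continuous_on_cyl_point_density(2) by (auto intro: borel_measurable_continuous_onI)
  show "AE z in lborel. norm (q (cyl_point r z)) \<le> norm (indicator {-C..C} z * M)"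
    unfolding real_norm_def by (intro AE_I2 order_trans[OF abs_cyl_point_le abs_ge_self])
qed

text \<open>All vertical sections are dominated by \<open>M\<close> on the fixed interval
  \<open>{-C..C}\<close>. The continuity is what makes the flux differentiable in the
  radius.\<close>

lemma continuous_on_column: "continuous_on UNIV (column q)"
  unfolding column_def[abs_def]
proof (rule continuous_on_sequentiallyI)
  fix t :: "nat \<Rightarrow> real" and a
  assume lim: "t \<longlonglongrightarrow> a"
  show "(\<lambda>n. LINT z|lborel. q (cyl_point (t n) z)) \<longlonglongrightarrow> (LINT z|lborel. q (cyl_point a z))"
  proof (rule integral_dominated_convergence[OF _ _ integrable_indicator_Icc_mult])
    show "AE z in lborel. (\<lambda>n. q (cyl_point (t n) z)) \<longlonglongrightarrow> q (cyl_point a z)"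
      using continuous_on_cyl_point_density(1)
      by (intro AE_I2 isCont_tendsto_compose[OF _ lim]) (simp add: continuous_on_eq_continuous_at)
    show "AE z in lborel. norm (q (cyl_point (t n) z)) \<le> indicator {-C..C} z * M" for n
      unfolding real_norm_def by (intro AE_I2 abs_cyl_point_le)
  qed (use integrable_cyl_point in auto)
qed

end

section \<open>The star profile and its derivative under dilation\<close>

text \<open>The analytic content of being a rotating star. The additive constant \<open>c\<close> is
  left general, since a constant pairs to zero with a perturbation of zero mass.\<close>

locale star_profile = bounded_density \<rho> M C for \<rho> M C +
  fixes A \<epsilon> c :: real
  assumes A_pos: "0 < A"
    and nonneg: "0 \<le> \<rho> x"
    and axisym: "axisymmetric \<rho>"
    and center_pos: "0 < \<rho> 0"
    and star_shaped: "0 < \<rho> x \<Longrightarrow> 0 \<le> t \<Longrightarrow> t \<le> 1 \<Longrightarrow> 0 < \<rho> (t *\<^sub>R x)"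
    and equilibrium: "0 < \<rho> x \<Longrightarrow> dPhi A (\<rho> x) = \<epsilon>\<^sup>2 / 2 * (cyl_radius x)\<^sup>2 + newton \<rho> x - c"
begin

text \<open>Inside the star \<open>cbrt\<close> is the cube root of \<open>\<rho>\<close>; unlike the latter it is differentiable along
  rays across the surface, where it vanishes.\<close>

definition cbrt where
  "cbrt x = (\<epsilon>\<^sup>2 / 2 * (cyl_radius x)\<^sup>2 + newton \<rho> x - c) / (4 * A)"

text \<open>The derivative of \<open>cbrt\<close> along the ray at \<open>s = 1\<close>; the square
  of the cylindrical radius is homogeneous of degree 2, which removes the factor 1/2.\<close>

definition cbrt' where
  "cbrt' x = (\<epsilon>\<^sup>2 * (cyl_radius x)\<^sup>2 + newton_radial \<rho> x) / (4 * A)"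

text \<open>The self-similar direction in closed form: inside the star, three times \<rho> from the
  factor \<open>l ^ 3\<close>, plus the radial derivative of \<rho> as the cube of
  \<open>cbrt\<close>.\<close>

definition dir where
  "dir x = (if 0 < \<rho> x then 3 * \<rho> x + 3 * (cbrt x)\<^sup>2 * cbrt' x else 0)"

lemma rho_eq_0: "\<not> 0 < \<rho> x \<Longrightarrow> \<rho> x = 0"
  using nonneg[of x] by linarith

lemma cbrt_eq: "0 < \<rho> x \<Longrightarrow> cbrt x = \<rho> x powr (1/3)"
  using equilibrium[of x] A_pos unfolding cbrt_def dPhi_def by (metis less_irrefl mult_eq_0_iff nonzero_mult_div_cancel_left zero_neq_numeral)

lemma cbrt_pos: "0 < \<rho> x \<Longrightarrow> 0 < cbrt x"
  by (simp add: cbrt_eq)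

lemma cbrt_cube: "0 < \<rho> x \<Longrightarrow> cbrt x ^ 3 = \<rho> x"
  by (simp add: cbrt_eq powr_power)

lemma cbrt_has_radial_derivative:
  "((\<lambda>s. cbrt (s *\<^sub>R x)) has_real_derivative cbrt' x) (at 1)"
proof -
  have eq: "cbrt (s *\<^sub>R x) = (\<epsilon>\<^sup>2 / 2 * (s\<^sup>2 * (cyl_radius x)\<^sup>2) + newton \<rho> (s *\<^sub>R x) - c) / (4 * A)" for s
    by (simp add: cbrt_def cyl_radius_scaleR power_mult_distrib)
  show ?thesis
    unfolding eq cbrt'_def
    by (rule DERIV_cdivide) (auto intro!: derivative_eq_intros newton_has_radial_derivative)
qed

text \<open>Three cases. Inside the star \<rho> is locally the cube of \<open>cbrt\<close>. If the
  ray has left the star before \<open>x\<close>, then \<rho> vanishes near \<open>x\<close> along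
  the ray. At a surface point \<rho> is squeezed by the cube of \<open>cbrt\<close>, whose
  derivative vanishes there.\<close>

lemma rho_has_radial_derivative:
  "((\<lambda>s. \<rho> (s *\<^sub>R x)) has_real_derivative dir x - 3 * \<rho> x) (at 1)"
proof (cases "0 < \<rho> x")
  case True
  have "((\<lambda>s. cbrt (s *\<^sub>R x) ^ 3) has_real_derivative 3 * (cbrt x)\<^sup>2 * cbrt' x) (at 1)"
    by (auto intro!: derivative_eq_intros cbrt_has_radial_derivative)
  moreover have "open {s. 0 < \<rho> (s *\<^sub>R x)}"
    by (intro open_Collect_less continuous_on_compose2[OF continuous] continuous_intros) auto
  ultimately have "((\<lambda>s. \<rho> (s *\<^sub>R x)) has_real_derivative 3 * (cbrt x)\<^sup>2 * cbrt' x) (at 1)"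
    by (rule has_field_derivative_transform_within_open) (use True in \<open>simp_all add: cbrt_cube\<close>)
  then show ?thesis using True by (simp add: dir_def)
next
  case False
  then have x0: "\<rho> x = 0" by (rule rho_eq_0)
  have "((\<lambda>s. \<rho> (s *\<^sub>R x)) has_real_derivative 0) (at 1)"
  proof (cases "\<exists>t\<in>{0..<1}. \<rho> (t *\<^sub>R x) = 0")
    case True
    then obtain t where t: "0 \<le> t" "t < 1" "\<rho> (t *\<^sub>R x) = 0" by auto
    \<comment> \<open>The factor \<open>t / s\<close> carries \<open>s *\<^sub>R x\<close> back to
      \<open>t *\<^sub>R x\<close>, so a positive value at the former would contradict the zero at
      the latter.\<close>
    have "\<rho> (s *\<^sub>R x) = 0" if "s \<in> {t<..}" for s
      using star_shaped[of "s *\<^sub>R x" "t / s"] t that rho_eq_0[of "s *\<^sub>R x"] by fastforce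
    then show ?thesis
      by (intro has_field_derivative_transform_within_open[OF DERIV_const[of 0], of "{t<..}"])
        (use t in auto)
  next
    case inside: False
    then have pos: "0 < \<rho> (s *\<^sub>R x)" if "0 \<le> s" "s < 1" for s
      using that nonneg[of "s *\<^sub>R x"] by (metis atLeastLessThan_iff order_le_less)
    \<comment> \<open>Both \<rho> and the cube of \<open>cbrt\<close> are continuous along the ray
      and agree for \<open>s\<close> just below 1, so they agree at \<open>x\<close>, and
      \<open>cbrt\<close> vanishes there.\<close>
    have cont: "isCont (\<lambda>s. cbrt (s *\<^sub>R x) ^ 3) 1"
      by (intro continuous_intros DERIV_isCont[OF cbrt_has_radial_derivative])
    then have "((\<lambda>s. cbrt (s *\<^sub>R x) ^ 3) \<longlongrightarrow> cbrt x ^ 3) (at_left 1)"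
      by (simp add: isCont_def filterlim_at_split)
    moreover have "continuous_on UNIV (\<lambda>s. \<rho> (s *\<^sub>R x))"
      by (intro continuous_on_compose2[OF continuous] continuous_intros) auto
    then have "isCont (\<lambda>s. \<rho> (s *\<^sub>R x)) 1" by (simp add: continuous_on_eq_continuous_at)
    then have "((\<lambda>s. \<rho> (s *\<^sub>R x)) \<longlongrightarrow> \<rho> x) (at_left 1)"
      by (simp add: isCont_def filterlim_at_split)
    then have "((\<lambda>s. cbrt (s *\<^sub>R x) ^ 3) \<longlongrightarrow> \<rho> x) (at_left 1)"
    proof (rule Lim_transform_eventually)
      have "eventually (\<lambda>s::real. s \<in> {0<..<1}) (at_left 1)"
        by (intro eventually_at_leftI[of 0]) auto
      then show "eventually (\<lambda>s. \<rho> (s *\<^sub>R x) = cbrt (s *\<^sub>R x) ^ 3) (at_left 1)"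
        by eventually_elim (use pos cbrt_cube in auto)
    qed
    ultimately have "cbrt x ^ 3 = \<rho> x"
      by (intro tendsto_unique[of "at_left (1::real)"]) auto
    then have cbrt0: "cbrt x = 0" by (simp add: x0)
    show ?thesis
    proof (rule has_real_derivative_zero_squeeze)
      show "((\<lambda>s. cbrt (s *\<^sub>R x) ^ 3) has_real_derivative 0) (at 1)"
        by (auto intro!: derivative_eq_intros cbrt_has_radial_derivative simp: cbrt0)
      have "eventually (\<lambda>s::real. s \<in> {0<..}) (at 1)"
        by (intro eventually_at_topological[THEN iffD2] exI[of _ "{0<..}"]) auto
      then show "eventually (\<lambda>s. \<bar>\<rho> (s *\<^sub>R x)\<bar> \<le> \<bar>cbrt (s *\<^sub>R x) ^ 3\<bar>) (at 1)"
      proof eventually_elim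
        case (elim s)
        show ?case
        proof (cases "s < 1")
          case True
          then show ?thesis using pos[of s] cbrt_cube elim by simp
        next
          case s: False
          have "\<not> 0 < \<rho> (s *\<^sub>R x)"
            using star_shaped[of "s *\<^sub>R x" "1 / s"] s False by auto
          then show ?thesis by (simp add: rho_eq_0)
        qed
      qed
    qed (simp_all add: cbrt0 x0)
  qed
  then show ?thesis using False x0 by (simp add: dir_def)
qed

text \<open>The derivative at a general \<open>l\<close> is reduced to the one at 1 by writing
  \<open>s = (s / l) * l\<close>. Values of \<open>l\<close> other than 1 matter for the mean value
  estimate on difference quotients.\<close>

lemma rescaled_has_real_derivative:
  assumes l: "0 < l"
  shows "((\<lambda>l. rescaled \<rho> l x) has_real_derivative l\<^sup>2 * dir (l *\<^sub>R x)) (at l)"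
proof -
  have "((\<lambda>s. \<rho> (s *\<^sub>R (l *\<^sub>R x))) has_real_derivative dir (l *\<^sub>R x) - 3 * \<rho> (l *\<^sub>R x)) (at (l / l))"
    using rho_has_radial_derivative[of "l *\<^sub>R x"] l by simp
  moreover have "((\<lambda>s. s / l) has_real_derivative 1 / l) (at l)"
    using l by (auto intro!: derivative_eq_intros)
  ultimately have "((\<lambda>s. \<rho> ((s / l) *\<^sub>R (l *\<^sub>R x))) has_real_derivative
      (dir (l *\<^sub>R x) - 3 * \<rho> (l *\<^sub>R x)) * (1 / l)) (at l)"
    by (rule DERIV_chain2)
  then have "((\<lambda>s. \<rho> (s *\<^sub>R x)) has_real_derivative
      (dir (l *\<^sub>R x) - 3 * \<rho> (l *\<^sub>R x)) * (1 / l)) (at l)"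
    using l by (simp only: scaleR_scaleR nonzero_divide_eq_eq times_divide_eq_left) simp
  moreover have "((\<lambda>s. s ^ 3) has_real_derivative 3 * l\<^sup>2) (at l)"
    by (auto intro!: derivative_eq_intros)
  ultimately have "((\<lambda>s. s ^ 3 * \<rho> (s *\<^sub>R x)) has_real_derivative
      3 * l\<^sup>2 * \<rho> (l *\<^sub>R x) + (dir (l *\<^sub>R x) - 3 * \<rho> (l *\<^sub>R x)) * (1 / l) * l ^ 3) (at l)"
    by (rule DERIV_mult[rotated])
  moreover have "3 * l\<^sup>2 * r + (d - 3 * r) * (1 / l) * l ^ 3 = l\<^sup>2 * d" for r d
    using l by (simp add: power3_eq_cube power2_eq_square algebra_simps)
  ultimately show ?thesis by (simp only: rescaled_def)
qed

lemma self_similar_dir_eq: "self_similar_dir \<rho> = dir"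
  using rescaled_has_real_derivative[of 1] by (auto simp: self_similar_dir_def intro!: ext DERIV_imp_deriv)

lemma axisymmetric_dir: "axisymmetric dir"
proof -
  have "self_similar_dir \<rho> x = self_similar_dir \<rho> y" if "cyl_radius x = cyl_radius y" "x $ 3 = y $ 3" for x y
  proof -
    have "rescaled \<rho> l x = rescaled \<rho> l y" for l
      using axisym[unfolded axisymmetric_def, rule_format, of "l *\<^sub>R x" "l *\<^sub>R y"] that
      by (simp add: rescaled_def cyl_radius_scaleR)
    then show ?thesis by (simp add: self_similar_dir_def)
  qed
  then show ?thesis unfolding axisymmetric_def self_similar_dir_eq by blast
qed

lemma measurable_dir [measurable]: "dir \<in> borel_measurable borel"
proof (rule borel_measurable_LIMSEQ_real)
  let ?t = "\<lambda>n. 1 + inverse (real (Suc n))"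
  have [measurable]: "rescaled \<rho> l \<in> borel_measurable borel" for l
    unfolding rescaled_def[abs_def] by measurable
  show "(\<lambda>x. (rescaled \<rho> (?t n) x - rescaled \<rho> 1 x) / (?t n - 1)) \<in> borel_measurable borel" for n
    by measurable
  fix x
  have "((\<lambda>l. (rescaled \<rho> l x - rescaled \<rho> 1 x) / (l - 1)) \<longlongrightarrow> dir x) (at 1)"
    using rescaled_has_real_derivative[of 1 x] by (simp add: has_field_derivative_iff)
  moreover have "?t \<longlonglongrightarrow> 1 + 0"
    by (intro tendsto_intros LIMSEQ_inverse_real_of_nat)
  then have "filterlim ?t (at 1) sequentially"
    by (auto simp: filterlim_at)
  ultimately show "(\<lambda>n. (rescaled \<rho> (?t n) x - rescaled \<rho> 1 x) / (?t n - 1)) \<longlonglongrightarrow> dir x"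
    by (rule filterlim_compose)
qed

section \<open>Uniform bounds on the self-similar direction\<close>

lemma cbrt_le: "0 < \<rho> x \<Longrightarrow> cbrt x \<le> M powr (1/3)"
  using abs_le[of x] by (simp add: cbrt_eq powr_mono2)

lemma abs_cbrt'_le:
  assumes "0 < \<rho> x"
  shows "\<bar>cbrt' x\<bar> \<le> (\<epsilon>\<^sup>2 * C\<^sup>2 + 4 * pi * M * C * (C + C)) / (4 * A)"
proof -
  have x: "norm x \<le> C" using assms support[of x] by simp
  have "cyl_radius x \<le> C" using x cyl_radius_le_norm[of x] by linarith
  then have "\<epsilon>\<^sup>2 * (cyl_radius x)\<^sup>2 \<le> \<epsilon>\<^sup>2 * C\<^sup>2"
    by (intro mult_left_mono power_mono) auto
  moreover have "\<bar>newton_radial \<rho> x\<bar> \<le> 4 * pi * M * C * (C + C)"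
    using x M_nonneg C_nonneg by (intro order_trans[OF abs_newton_radial_le] mult_mono) auto
  moreover have "\<bar>\<epsilon>\<^sup>2 * (cyl_radius x)\<^sup>2\<bar> = \<epsilon>\<^sup>2 * (cyl_radius x)\<^sup>2" by simp
  ultimately have "\<bar>\<epsilon>\<^sup>2 * (cyl_radius x)\<^sup>2 + newton_radial \<rho> x\<bar> \<le> \<epsilon>\<^sup>2 * C\<^sup>2 + 4 * pi * M * C * (C + C)"
    by linarith
  then show ?thesis
    using A_pos by (simp add: cbrt'_def divide_right_mono)
qed

definition dir_bound where
  "dir_bound = 3 * M + 3 * (M powr (1/3))\<^sup>2 * ((\<epsilon>\<^sup>2 * C\<^sup>2 + 4 * pi * M * C * (C + C)) / (4 * A))"

lemma dir_support: "dir x \<noteq> 0 \<Longrightarrow> 0 < \<rho> x"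
  by (auto simp: dir_def split: if_splits)

lemma abs_dir_le: "\<bar>dir x\<bar> \<le> dir_bound"
proof (cases "0 < \<rho> x")
  case True
  have "\<bar>3 * \<rho> x\<bar> \<le> 3 * M" using abs_le[of x] by simp
  moreover have "\<bar>3 * (cbrt x)\<^sup>2 * cbrt' x\<bar> = 3 * (cbrt x)\<^sup>2 * \<bar>cbrt' x\<bar>"
    by (simp add: abs_mult)
  moreover have "3 * (cbrt x)\<^sup>2 * \<bar>cbrt' x\<bar> \<le>
      3 * (M powr (1/3))\<^sup>2 * ((\<epsilon>\<^sup>2 * C\<^sup>2 + 4 * pi * M * C * (C + C)) / (4 * A))"
    using cbrt_le[OF True] cbrt_pos[OF True] abs_cbrt'_le[OF True]
    by (intro mult_mono power_mono) auto
  ultimately show ?thesis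
    using True unfolding dir_def dir_bound_def by (smt (verit))
next
  case False
  then show ?thesis
    using M_nonneg A_pos C_nonneg by (simp add: dir_def dir_bound_def)
qed

lemma dir_bound_nonneg: "0 \<le> dir_bound"
  using abs_dir_le[of 0] by linarith

lemma rescaled_1 [simp]: "rescaled \<rho> 1 = \<rho>"
  by (simp add: rescaled_def fun_eq_iff)

section \<open>Differentiating integrals over the rescaled stars\<close>

text \<open>Mean value estimate in \<open>l\<close>; the constant 4 bounds the factor
  \<open>s\<^sup>2\<close> of the derivative on \<open>{1/2..2}\<close>.\<close>

lemma abs_rescaled_diff_le:
  assumes l: "l \<in> {1/2..2}"
  shows "\<bar>rescaled \<rho> l x - \<rho> x\<bar> \<le> 4 * dir_bound * \<bar>l - 1\<bar>"
proof -
  have "norm (rescaled \<rho> l x - rescaled \<rho> 1 x) \<le> 4 * dir_bound * norm (l - 1)"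
  proof (rule field_differentiable_bound[of "{1/2..2}"])
    fix s :: real assume s: "s \<in> {1/2..2}"
    show "((\<lambda>l. rescaled \<rho> l x) has_real_derivative s\<^sup>2 * dir (s *\<^sub>R x)) (at s within {1/2..2})"
      using s by (intro has_field_derivative_at_within[OF rescaled_has_real_derivative]) auto
    have "s\<^sup>2 \<le> 2\<^sup>2" using s by (intro power_mono) auto
    then have "s\<^sup>2 * \<bar>dir (s *\<^sub>R x)\<bar> \<le> 4 * dir_bound"
      by (intro mult_mono abs_dir_le) auto
    then show "norm (s\<^sup>2 * dir (s *\<^sub>R x)) \<le> 4 * dir_bound"
      by (simp add: abs_mult)
  qed (use l in auto)
  then show ?thesis by simp
qed

lemma rescaled_support:
  assumes "l \<in> {1/2..2}" "rescaled \<rho> l x \<noteq> 0"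
  shows "norm x \<le> 2 * C"
proof -
  have "norm (l *\<^sub>R x) \<le> C" using assms(2) by (intro support) (simp add: rescaled_def)
  moreover have "1/2 * norm x \<le> \<bar>l\<bar> * norm x"
    using assms(1) by (intro mult_right_mono) auto
  ultimately show ?thesis by simp
qed

text \<open>Dominated convergence: for \<open>l\<close> in \<open>{1/2..2}\<close> the difference
  quotients are at most \<open>4 * dir_bound\<close> and vanish outside the ball of radius
  \<open>2 * C\<close>. Local integrability of \<open>K\<close> suffices and admits constants, the
  Newtonian kernel and indicators of cylinders.\<close>

lemma integral_rescaled_has_derivative:
  assumes [measurable]: "K \<in> borel_measurable borel"
    and loc: "\<And>R. integrable lborel (\<lambda>y. indicator (cball 0 R) y * K y)"
  shows "((\<lambda>l. LINT y|lborel. rescaled \<rho> l y * K y) has_real_derivative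
    (LINT y|lborel. dir y * K y)) (at 1)"
proof -
  have [measurable]: "rescaled \<rho> l \<in> borel_measurable borel" for l
    unfolding rescaled_def[abs_def] by measurable
  let ?w = "\<lambda>B y. B * \<bar>indicator (cball 0 (2 * C)) y * K y\<bar>"
  have w: "integrable lborel (?w B)" for B
    by (intro integrable_mult_right integrable_abs loc)
  have int: "integrable lborel (\<lambda>y. rescaled \<rho> l y * K y)" if l: "l \<in> {1/2..2}" for l
  proof (rule Bochner_Integration.integrable_bound[OF w[of "4 * dir_bound + M"]])
    show "AE y in lborel. norm (rescaled \<rho> l y * K y) \<le> norm (?w (4 * dir_bound + M) y)"
    proof (rule AE_I2)
      fix y
      have "\<bar>l - 1\<bar> \<le> 1" using l by auto
      then have "4 * dir_bound * \<bar>l - 1\<bar> \<le> 4 * dir_bound * 1"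
        using dir_bound_nonneg by (intro mult_left_mono) auto
      then have "\<bar>rescaled \<rho> l y\<bar> \<le> 4 * dir_bound + M"
        using abs_rescaled_diff_le[OF l, of y] abs_le[of y] by linarith
      then have "\<bar>rescaled \<rho> l y\<bar> * \<bar>K y\<bar> \<le> \<bar>4 * dir_bound + M\<bar> * \<bar>K y\<bar>"
        by (intro mult_right_mono) auto
      then show "norm (rescaled \<rho> l y * K y) \<le> norm (?w (4 * dir_bound + M) y)"
        using rescaled_support[OF l, of y] by (cases "rescaled \<rho> l y = 0") (auto simp: abs_mult)
    qed
  qed measurable
  have "((\<lambda>l. LINT y|lborel. rescaled \<rho> l y * K y) has_real_derivative
    (LINT y|lborel. dir y * K y)) (at 1 within {1/2..2})"
    unfolding has_field_derivative_iff tendsto_at_iff_sequentially comp_def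
  proof (intro allI impI)
    fix X :: "nat \<Rightarrow> real"
    assume "\<forall>i. X i \<in> {1/2..2} - {1}" and X1: "X \<longlonglongrightarrow> 1"
    then have X: "X i \<in> {1/2..2}" "X i \<noteq> 1" for i by auto
    have one: "(1::real) \<in> {1/2..2}" by simp
    have eq: "((LINT y|lborel. rescaled \<rho> (X i) y * K y) - (LINT y|lborel. rescaled \<rho> 1 y * K y)) / (X i - 1) =
        (LINT y|lborel. (rescaled \<rho> (X i) y - rescaled \<rho> 1 y) / (X i - 1) * K y)" for i
    proof -
      have "(LINT y|lborel. rescaled \<rho> (X i) y * K y) - (LINT y|lborel. rescaled \<rho> 1 y * K y) =
          (LINT y|lborel. rescaled \<rho> (X i) y * K y - rescaled \<rho> 1 y * K y)"
        by (rule Bochner_Integration.integral_diff[symmetric, OF int[OF X(1)] int[OF one]])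
      then show ?thesis
        by (simp add: left_diff_distrib diff_divide_distrib flip: integral_divide_zero)
    qed
    show "(\<lambda>i. ((LINT y|lborel. rescaled \<rho> (X i) y * K y) - (LINT y|lborel. rescaled \<rho> 1 y * K y)) / (X i - 1))
        \<longlonglongrightarrow> (LINT y|lborel. dir y * K y)"
      unfolding eq
    proof (rule integral_dominated_convergence[OF _ _ w[of "4 * dir_bound"]])
      show "AE y in lborel. (\<lambda>i. (rescaled \<rho> (X i) y - rescaled \<rho> 1 y) / (X i - 1) * K y) \<longlonglongrightarrow> dir y * K y"
      proof (intro AE_I2 tendsto_mult tendsto_const)
        fix y
        have "((\<lambda>l. (rescaled \<rho> l y - rescaled \<rho> 1 y) / (l - 1)) \<longlongrightarrow> dir y) (at 1)"
          using rescaled_has_real_derivative[of 1 y] by (simp add: has_field_derivative_iff)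
        moreover have "filterlim X (at 1) sequentially"
          using X1 X(2) by (simp add: filterlim_at)
        ultimately show "(\<lambda>i. (rescaled \<rho> (X i) y - rescaled \<rho> 1 y) / (X i - 1)) \<longlonglongrightarrow> dir y"
          by (rule filterlim_compose)
      qed
      show "AE y in lborel. norm ((rescaled \<rho> (X i) y - rescaled \<rho> 1 y) / (X i - 1) * K y)
          \<le> ?w (4 * dir_bound) y" for i
      proof (rule AE_I2)
        fix y
        show "norm ((rescaled \<rho> (X i) y - rescaled \<rho> 1 y) / (X i - 1) * K y) \<le> ?w (4 * dir_bound) y"
        proof (cases "norm y \<le> 2 * C")
          case True
          have "\<bar>rescaled \<rho> (X i) y - \<rho> y\<bar> / \<bar>X i - 1\<bar> \<le> 4 * dir_bound"
            using abs_rescaled_diff_le[OF X(1), of i y] X(2)[of i] by (simp add: divide_le_eq)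
          then have "\<bar>rescaled \<rho> (X i) y - \<rho> y\<bar> / \<bar>X i - 1\<bar> * \<bar>K y\<bar> \<le> 4 * dir_bound * \<bar>K y\<bar>"
            by (intro mult_right_mono) auto
          then show ?thesis using True by (simp add: abs_mult)
        next
          case False
          then have "rescaled \<rho> (X i) y = 0" "rescaled \<rho> 1 y = 0"
            using rescaled_support[OF X(1)] rescaled_support[OF one] by blast+
          then show ?thesis using dir_bound_nonneg by simp
        qed
      qed
    qed measurable
  qed
  moreover have "at (1::real) within {1/2..2} = at 1"
    by (rule at_within_interior) simp
  ultimately show ?thesis by simp
qed

lemma integral_rescaled:
  assumes [measurable]: "K \<in> borel_measurable borel" and l: "0 < l"
  shows "(LINT y|lborel. rescaled \<rho> l y * K y) = (LINT u|lborel. \<rho> u * K ((1 / l) *\<^sub>R u))"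
  using integral_lborel_affine[of l "\<lambda>u. \<rho> u * K ((1 / l) *\<^sub>R u)" 0] l
  by (simp add: rescaled_def mult.assoc)

text \<open>The substitution \<open>u = l *\<^sub>R y\<close> moves the dilation from the star to
  the kernel, because \<open>l ^ 3\<close> is exactly the Jacobian. Pairings with \<open>dir\<close>
  are then derivatives of explicit scaling laws \<open>F\<close>, and \<rho> itself is not
  differentiated.\<close>

lemma integral_dir_eq:
  assumes "K \<in> borel_measurable borel"
    and "\<And>R. integrable lborel (\<lambda>y. indicator (cball 0 R) y * K y)"
    and F: "\<And>l. 0 < l \<Longrightarrow> (LINT u|lborel. \<rho> u * K ((1 / l) *\<^sub>R u)) = F l"
    and F': "(F has_real_derivative D) (at 1)"
  shows "(LINT y|lborel. dir y * K y) = D"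
proof (rule DERIV_unique[OF integral_rescaled_has_derivative[OF assms(1,2)]])
  show "((\<lambda>l. LINT y|lborel. rescaled \<rho> l y * K y) has_real_derivative D) (at 1)"
    by (rule has_field_derivative_transform_within_open[OF F', of "{0<..}"])
      (auto simp: integral_rescaled[OF assms(1)] F)
qed

section \<open>Mass and potential of the self-similar direction\<close>

lemma integrable_indicator_cball: "integrable lborel (\<lambda>y::real^3. indicator (cball 0 R) y :: real)"
  using emeasure_bounded_finite[OF bounded_cball] by (intro integrable_real_indicator) simp_all

lemma integral_dir: "(LINT y|lborel. dir y) = 0"
  using integral_dir_eq[of "\<lambda>_. 1" "\<lambda>_. LINT u|lborel. \<rho> u" 0] integrable_indicator_cball by simp

text \<open>The kernel is homogeneous of degree -1, so the rescaled star has the potential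
  \<open>l * newton \<rho> (l *\<^sub>R x)\<close>; the product rule at \<open>l = 1\<close> gives
  the two terms.\<close>

lemma newton_dir: "newton dir x = newton \<rho> x + newton_radial \<rho> x"
proof -
  have "(LINT y|lborel. dir y * (1 / norm (x - y))) = newton \<rho> x + newton_radial \<rho> x"
  proof (rule integral_dir_eq)
    fix R
    \<comment> \<open>The absolute value provides the nonnegative radius that
      \<open>integrable_newton\<close> asks for, and the larger ball contains
      \<open>cball 0 R\<close>.\<close>
    have "integrable lborel (\<lambda>y. indicator (cball 0 \<bar>R\<bar>) y / norm (x - y))"
      by (rule integrable_newton[where M = 1 and C = "\<bar>R\<bar>"]) (auto simp: indicator_def)
    then show "integrable lborel (\<lambda>y. indicator (cball 0 R) y * (1 / norm (x - y)))"
      by (rule Bochner_Integration.integrable_bound) (auto simp: indicator_def)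
  next
    fix l :: real assume l: "0 < l"
    have "\<rho> u * (1 / norm (x - (1 / l) *\<^sub>R u)) = l * (\<rho> u / norm (l *\<^sub>R x - u))" for u
    proof -
      have "l *\<^sub>R x - u = l *\<^sub>R (x - (1 / l) *\<^sub>R u)" using l by (simp add: scaleR_diff_right)
      then show ?thesis using l by simp
    qed
    then show "(LINT u|lborel. \<rho> u * (1 / norm (x - (1 / l) *\<^sub>R u))) = l * newton \<rho> (l *\<^sub>R x)"
      by (simp only: newton_def integral_mult_right_zero)
  next
    show "((\<lambda>l. l * newton \<rho> (l *\<^sub>R x)) has_real_derivative newton \<rho> x + newton_radial \<rho> x) (at 1)"
      by (auto intro!: derivative_eq_intros newton_has_radial_derivative)
  qed measurable
  then show ?thesis by (simp add: newton_def)
qed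

end

section \<open>The quadratic forms\<close>

lemma measurable_flux [measurable]:
  assumes [measurable]: "g \<in> borel_measurable borel"
  shows "flux g \<in> borel_measurable borel"
proof -
  have "flux g = (\<lambda>r. LINT s|lborel. (if 0 \<le> s \<and> s \<le> r then s * column g s else 0))"
    by (auto simp: flux_def set_lebesgue_integral_def fun_eq_iff indicator_def
        intro!: Bochner_Integration.integral_cong)
  then show ?thesis by simp
qed

section \<open>Fluxes and their derivatives\<close>

context bounded_density
begin

lemma integrable_density: "integrable lborel q"
proof (rule Bochner_Integration.integrable_bound)
  show "integrable lborel (\<lambda>y. M * indicator (cball 0 C) y)"
    by (intro integrable_mult_right integrable_real_indicator)
      (use emeasure_bounded_finite[OF bounded_cball, of 0 C] in simp_all)
  show "AE y in lborel. norm (q y) \<le> norm (M * indicator (cball 0 C) y)"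
    using abs_le support M_nonneg by (intro AE_I2) (auto simp: indicator_def)
qed measurable

lemma flux_eq_integral: "flux q r = integral {0..r} (\<lambda>s. s * column q s)"
  unfolding flux_def
  by (intro set_borel_integral_eq_integral borel_integrable_atLeastAtMost' continuous_intros
      continuous_on_subset[OF continuous_on_column]) auto

lemma flux_has_real_derivative:
  assumes r: "0 < r"
  shows "(flux q has_real_derivative r * column q r) (at r)"
proof -
  have "continuous_on {0..2 * r} (\<lambda>s. s * column q s)"
    by (intro continuous_intros continuous_on_subset[OF continuous_on_column]) auto
  then have "((\<lambda>t. integral {0..t} (\<lambda>s. s * column q s)) has_real_derivative r * column q r)
      (at r within {0..2 * r})"
    using r by (intro integral_has_real_derivative) auto
  moreover have "at r within {0..2 * r} = at r"
    using r by (intro at_within_interior) simp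
  ultimately show ?thesis by (simp add: flux_eq_integral[abs_def])
qed

end

context star_profile
begin

text \<open>Take the indicator of a solid cylinder as kernel: the rescaled star has inside radius
  \<open>r\<close> the mass that \<rho> has inside radius \<open>l * r\<close>. The factor
  \<open>column \<rho> r\<close> in the result cancels the denominator of
  \<open>op_T\<close>.\<close>

lemma flux_dir:
  assumes r: "0 < r"
  shows "flux dir r = r\<^sup>2 * column \<rho> r"
proof -
  have "(LINT y|lborel. dir y * indicator {..r} (cyl_radius y)) = 2 * pi * (r * (r * column \<rho> r))"
  proof (rule integral_dir_eq)
    fix R
    show "integrable lborel (\<lambda>y::real^3. indicator (cball 0 R) y * indicator {..r} (cyl_radius y) :: real)"
      by (rule Bochner_Integration.integrable_bound[OF integrable_indicator_cball[of R]])
        (auto simp: indicator_def)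
  next
    fix l :: real assume l: "0 < l"
    have "\<rho> u * indicator {..r} (cyl_radius ((1 / l) *\<^sub>R u)) = indicator {..l * r} (cyl_radius u) * \<rho> u" for u
      using l by (simp add: cyl_radius_scaleR indicator_def field_simps)
    then show "(LINT u|lborel. \<rho> u * indicator {..r} (cyl_radius ((1 / l) *\<^sub>R u))) = 2 * pi * flux \<rho> (l * r)"
      by (simp only: integral_cylinder_eq_flux[OF integrable_density measurable_density axisym])
  next
    have "((\<lambda>l. l * r) has_real_derivative r) (at 1)"
      by (auto intro!: derivative_eq_intros)
    moreover have "(flux \<rho> has_real_derivative r * column \<rho> r) (at (1 * r))"
      using flux_has_real_derivative[OF r] by simp
    ultimately have "((\<lambda>l. flux \<rho> (l * r)) has_real_derivative r * column \<rho> r * r) (at 1)"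
      by (rule DERIV_chain2[rotated])
    then show "((\<lambda>l. 2 * pi * flux \<rho> (l * r)) has_real_derivative 2 * pi * (r * (r * column \<rho> r))) (at 1)"
      by (auto intro!: derivative_eq_intros)
  qed measurable
  moreover have "integrable lborel dir"
  proof (rule Bochner_Integration.integrable_bound)
    show "integrable lborel (\<lambda>y::real^3. dir_bound * indicator (cball 0 C) y)"
      by (intro integrable_mult_right integrable_indicator_cball)
    have "norm (dir y) \<le> norm (dir_bound * indicator (cball 0 C) y)" for y
      using abs_dir_le[of y] dir_support[of y] support[of y]
      by (cases "dir y = 0") auto
    then show "AE y in lborel. norm (dir y) \<le> norm (dir_bound * indicator (cball 0 C) y)"
      by (rule AE_I2)
  qed measurable
  ultimately show ?thesis
    using integral_cylinder_eq_flux[of dir r] axisymmetric_dir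
    by (simp add: mult.commute power2_eq_square mult.assoc)
qed

section \<open>The rotational form paired with the self-similar direction\<close>

lemma cyl_radius_le_C: "0 < \<rho> x \<Longrightarrow> cyl_radius x \<le> C"
  using support[of x] cyl_radius_le_norm[of x] by fastforce

lemma cyl_radius_le_equatorial: "0 < \<rho> x \<Longrightarrow> cyl_radius x \<le> equatorial_radius \<rho>"
  unfolding equatorial_radius_def star_region_def
  using cyl_radius_le_C by (intro cSup_upper bdd_aboveI[of _ C]) auto

lemma equatorial_radius_nonneg: "0 \<le> equatorial_radius \<rho>"
  using cyl_radius_le_equatorial[OF center_pos] by (simp add: cyl_radius_def)

text \<open>A point of the star farther than \<open>r\<close> from the axis is pulled along its ray
  to distance exactly \<open>r\<close>, staying in the star. The vertical section at
  \<open>r\<close> is then a nonempty open set, so its integral is positive.\<close>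

lemma column_pos:
  assumes r: "0 < r" "r < equatorial_radius \<rho>"
  shows "0 < column \<rho> r"
proof -
  obtain x where x: "0 < \<rho> x" "r < cyl_radius x"
    using less_cSupE[OF r(2)[unfolded equatorial_radius_def]] center_pos
    by (auto simp: star_region_def)
  define z where "z = ((r / cyl_radius x) *\<^sub>R x) $ 3"
  have "0 < \<rho> ((r / cyl_radius x) *\<^sub>R x)"
    using x r by (intro star_shaped) auto
  also have "\<rho> ((r / cyl_radius x) *\<^sub>R x) = \<rho> (cyl_point r z)"
    using axisymmetric_cyl_point[OF axisym, of "(r / cyl_radius x) *\<^sub>R x"] x r
    by (simp add: z_def cyl_radius_scaleR)
  finally have z: "z \<in> {z. 0 < \<rho> (cyl_point r z)}" by simp
  have op: "open {z. 0 < \<rho> (cyl_point r z)}"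
    by (intro open_Collect_less continuous_on_cyl_point_density continuous_intros)
  have "column \<rho> r \<noteq> 0"
  proof
    assume "column \<rho> r = 0"
    then have "AE z in lborel. \<rho> (cyl_point r z) = 0"
      using integral_nonneg_eq_0_iff_AE[OF integrable_cyl_point[of r]] nonneg by (simp add: column_def)
    then have "AE z in lebesgue. z \<notin> {z. 0 < \<rho> (cyl_point r z)}"
      unfolding AE_completion_iff by eventually_elim simp
    then have "negligible {z. 0 < \<rho> (cyl_point r z)}"
      using op by (simp add: negligible_iff_null_sets AE_iff_null_sets)
    then show False using open_not_negligible[OF op] z by blast
  qed
  moreover have "0 \<le> column \<rho> r"
    unfolding column_def using nonneg by (intro Bochner_Integration.integral_nonneg) simp
  ultimately show ?thesis by simp
qed

lemma integrable_cyl_radius_square_mult: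
  assumes \<tau>: "integrable lborel \<tau>" and supp: "\<And>x. \<tau> x \<noteq> 0 \<Longrightarrow> 0 < \<rho> x"
  shows "integrable lborel (\<lambda>x. (cyl_radius x)\<^sup>2 * \<tau> x)"
proof (rule Bochner_Integration.integrable_bound[OF integrable_mult_right[OF \<tau>, of "C\<^sup>2"]])
  have "norm ((cyl_radius x)\<^sup>2 * \<tau> x) \<le> norm (C\<^sup>2 * \<tau> x)" for x
  proof (cases "\<tau> x = 0")
    case False
    have "(cyl_radius x)\<^sup>2 \<le> C\<^sup>2"
      using cyl_radius_le_C[OF supp[OF False]] by (intro power_mono) auto
    then show ?thesis by (simp add: abs_mult mult_right_mono)
  qed simp
  then show "AE x in lborel. norm ((cyl_radius x)\<^sup>2 * \<tau> x) \<le> norm (C\<^sup>2 * \<tau> x)" by (rule AE_I2)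
qed (use \<tau> in measurable)

text \<open>Once \<open>flux_dir\<close> has removed the quotient, the flux of \<tau> is written as
  a volume integral and the order of integration is exchanged. The inner integral of
  \<open>r\<close> runs from \<open>cyl_radius x\<close> to the equatorial radius, and its upper
  limit contributes a multiple of the mass of \<tau>, which is zero.\<close>

lemma op_T_dir:
  assumes \<tau>: "integrable lborel \<tau>" and [measurable]: "\<tau> \<in> borel_measurable borel"
    and ax: "axisymmetric \<tau>" and supp: "\<And>x. \<tau> x \<noteq> 0 \<Longrightarrow> 0 < \<rho> x"
    and zero: "(LINT x|lborel. \<tau> x) = 0"
  shows "op_T \<rho> dir \<tau> = - 1 / (4 * pi) * (LINT x|lborel. (cyl_radius x)\<^sup>2 * \<tau> x)"
proof -
  let ?R = "equatorial_radius \<rho>"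
  let ?H = "\<lambda>r x. indicator {0..?R} r * (r * (if cyl_radius x \<le> r then \<tau> x else 0))"
  have H: "integrable (lborel \<Otimes>\<^sub>M lborel) (case_prod ?H)"
  proof (rule lborel_pair.Fubini_integrable)
    show "case_prod ?H \<in> borel_measurable (lborel \<Otimes>\<^sub>M lborel)" by measurable
    have slice: "integrable lborel (\<lambda>x. ?H r x)" for r
      by (rule Bochner_Integration.integrable_bound[OF integrable_mult_right[OF \<tau>, of r]])
        (auto simp: abs_mult indicator_def)
    then show "AE r in lborel. integrable lborel (\<lambda>x. case_prod ?H (r, x))" by simp
    let ?I = "LINT x|lborel. \<bar>\<tau> x\<bar>"
    show "integrable lborel (\<lambda>r. LINT x|lborel. norm (case_prod ?H (r, x)))"
    proof (rule Bochner_Integration.integrable_bound)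
      show "integrable lborel (\<lambda>r. indicator {0..?R} r * (?R * ?I))"
        using equatorial_radius_nonneg by (intro integrable_mult_left integrable_real_indicator) auto
      have "norm (LINT x|lborel. norm (case_prod ?H (r, x))) \<le> norm (indicator {0..?R} r * (?R * ?I))" for r
      proof (cases "r \<in> {0..?R}")
        case True
        have "(LINT x|lborel. \<bar>?H r x\<bar>) \<le> (LINT x|lborel. ?R * \<bar>\<tau> x\<bar>)"
          using True equatorial_radius_nonneg
          by (intro integral_mono integrable_abs[OF slice] integrable_mult_right[OF integrable_abs[OF \<tau>]])
            (auto simp: abs_mult intro: mult_right_mono)
        also have "\<dots> = ?R * ?I" by simp
        finally have "(LINT x|lborel. \<bar>?H r x\<bar>) \<le> ?R * ?I" .
        moreover have "0 \<le> (LINT x|lborel. \<bar>?H r x\<bar>)" by simp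
        ultimately show ?thesis using True by simp
      qed simp
      then show "AE r in lborel. norm (LINT x|lborel. norm (case_prod ?H (r, x))) \<le> norm (indicator {0..?R} r * (?R * ?I))"
        by (rule AE_I2)
    qed measurable
  qed
  have "op_T \<rho> dir \<tau> = (LINT r|lborel. indicator {0..?R} r * (r * flux \<tau> r))"
    unfolding op_T_def set_lebesgue_integral_def
  proof (rule integral_cong_AE)
    \<comment> \<open>The two endpoints are discarded because \<open>column_pos\<close> gives a
      nonzero denominator only strictly between them.\<close>
    have "AE r in lborel. r \<noteq> 0" "AE r in lborel. r \<noteq> ?R" by (rule AE_lborel_singleton)+
    then show "AE r in lborel. indicator {0..?R} r *\<^sub>R (flux dir r * flux \<tau> r / (r * column \<rho> r)) =
        indicator {0..?R} r * (r * flux \<tau> r)"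
    proof eventually_elim
      case (elim r)
      show ?case
      proof (cases "r \<in> {0..?R}")
        case True
        then have "0 < r" "0 < column \<rho> r" using elim column_pos[of r] by auto
        then show ?thesis by (simp add: flux_dir power2_eq_square)
      qed simp
    qed
  qed measurable
  also have "\<dots> = (LINT r|lborel. 1 / (2 * pi) * (LINT x|lborel. ?H r x))"
  proof (rule Bochner_Integration.integral_cong[OF refl])
    fix r
    have "(LINT x|lborel. ?H r x) = indicator {0..?R} r * (r * (LINT x|lborel. (if cyl_radius x \<le> r then \<tau> x else 0)))"
      by (simp only: integral_mult_right_zero)
    also have "(LINT x|lborel. (if cyl_radius x \<le> r then \<tau> x else 0)) = (LINT x|lborel. indicator {..r} (cyl_radius x) * \<tau> x)"
      by (intro Bochner_Integration.integral_cong) (auto simp: indicator_def)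
    also have "\<dots> = 2 * pi * flux \<tau> r"
      by (rule integral_cylinder_eq_flux) (use \<tau> ax in auto)
    finally have "(LINT x|lborel. ?H r x) = indicator {0..?R} r * (r * (2 * pi * flux \<tau> r))" .
    then show "indicator {0..?R} r * (r * flux \<tau> r) = 1 / (2 * pi) * (LINT x|lborel. ?H r x)"
      by (simp only:) simp
  qed
  also have "\<dots> = 1 / (2 * pi) * (LINT r|lborel. LINT x|lborel. ?H r x)"
    by (rule integral_mult_right_zero)
  also have "(LINT r|lborel. LINT x|lborel. ?H r x) = (LINT x|lborel. LINT r|lborel. ?H r x)"
    by (rule lborel_pair.Fubini_integral[OF H, symmetric])
  also have "\<dots> = (LINT x|lborel. ?R\<^sup>2 / 2 * \<tau> x - 1 / 2 * ((cyl_radius x)\<^sup>2 * \<tau> x))"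
  proof (rule Bochner_Integration.integral_cong[OF refl])
    fix x
    show "(LINT r|lborel. ?H r x) = ?R\<^sup>2 / 2 * \<tau> x - 1 / 2 * ((cyl_radius x)\<^sup>2 * \<tau> x)"
    proof (cases "\<tau> x = 0")
      case False
      have "(LINT r|lborel. ?H r x) = (LINT r|lborel. \<tau> x * (r * indicator {cyl_radius x..?R} r))"
        by (intro Bochner_Integration.integral_cong)
          (auto simp: indicator_def intro: order_trans[OF cyl_radius_nonneg])
      also have "\<dots> = \<tau> x * (LINT r|lborel. r * indicator {cyl_radius x..?R} r)"
        by (rule integral_mult_right_zero)
      also have "(LINT r|lborel. r * indicator {cyl_radius x..?R} r) = ?R\<^sup>2 / 2 - (cyl_radius x)\<^sup>2 / 2"
        by (rule integral_FTC_Icc_real[OF cyl_radius_le_equatorial[OF supp[OF False]]])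
          (auto intro!: derivative_eq_intros)
      finally show ?thesis by (simp add: algebra_simps)
    qed (simp cong: if_cong)
  qed
  also have "\<dots> = - 1 / 2 * (LINT x|lborel. (cyl_radius x)\<^sup>2 * \<tau> x)"
  proof -
    have "integrable lborel (\<lambda>x. (cyl_radius x)\<^sup>2 * \<tau> x)"
      by (rule integrable_cyl_radius_square_mult[OF \<tau> supp])
    then have "(LINT x|lborel. ?R\<^sup>2 / 2 * \<tau> x - 1 / 2 * ((cyl_radius x)\<^sup>2 * \<tau> x)) =
        ?R\<^sup>2 / 2 * (LINT x|lborel. \<tau> x) - 1 / 2 * (LINT x|lborel. (cyl_radius x)\<^sup>2 * \<tau> x)"
      using \<tau> by (subst Bochner_Integration.integral_diff) (auto simp: integral_mult_right_zero)
    then show ?thesis by (simp add: zero)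
  qed
  finally show ?thesis by simp
qed

section \<open>The form of \<open>op_L\<close> paired with the self-similar direction\<close>

lemma ddPhi_eq: "0 < \<rho> x \<Longrightarrow> ddPhi A (\<rho> x) = 4 / 3 * A / (cbrt x)\<^sup>2"
proof -
  assume x: "0 < \<rho> x"
  have "\<rho> x powr (-2/3) = (\<rho> x powr (1/3)) powr (-2)"
    by (simp add: powr_powr)
  also have "\<dots> = 1 / (cbrt x)\<^sup>2"
    using cbrt_pos[OF x] by (simp add: cbrt_eq[OF x, symmetric] powr_minus inverse_eq_divide)
  finally show ?thesis by (simp add: ddPhi_def)
qed

text \<open>The factor \<open>(cbrt x)\<^sup>2\<close> contained in \<open>dir\<close> absorbs the
  singular weight, so the product stays bounded up to the surface.\<close>

lemma ddPhi_mult_dir: "0 < \<rho> x \<Longrightarrow> ddPhi A (\<rho> x) * dir x = 4 * A * (cbrt x + cbrt' x)"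
proof -
  assume x: "0 < \<rho> x"
  have "dir x = (cbrt x)\<^sup>2 * (3 * (cbrt x + cbrt' x))"
    using x cbrt_cube[OF x] by (simp add: dir_def power3_eq_cube power2_eq_square algebra_simps)
  then show ?thesis using cbrt_pos[OF x] by (simp add: ddPhi_eq[OF x])
qed

text \<open>The sum \<open>cbrt + cbrt'\<close> applies to the equilibrium equation the identity
  plus the derivative along the ray. This gives 1/2 + 1 = 3/2 in the centrifugal term, leaves the
  constant as it is, and yields the potential of \<open>dir\<close> by
  \<open>newton_dir\<close>.\<close>

lemma linearized_equilibrium:
  "0 < \<rho> x \<Longrightarrow> ddPhi A (\<rho> x) * dir x = newton dir x + 3 / 2 * \<epsilon>\<^sup>2 * (cyl_radius x)\<^sup>2 - c"
proof -
  have "4 * A * (cbrt x + cbrt' x) = 4 * A * cbrt x + 4 * A * cbrt' x" by (simp add: distrib_left)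
  also have "4 * A * cbrt x = \<epsilon>\<^sup>2 / 2 * (cyl_radius x)\<^sup>2 + newton \<rho> x - c"
    unfolding cbrt_def using A_pos by simp
  also have "4 * A * cbrt' x = \<epsilon>\<^sup>2 * (cyl_radius x)\<^sup>2 + newton_radial \<rho> x"
    unfolding cbrt'_def using A_pos by simp
  finally show "0 < \<rho> x \<Longrightarrow> ?thesis" by (simp add: ddPhi_mult_dir newton_dir)
qed

lemma star_region_measurable [measurable]: "star_region \<rho> \<in> sets borel"
  unfolding star_region_def by measurable

lemma set_integral_star_region_eq:
  fixes h \<tau> :: "real ^ 3 \<Rightarrow> real"
  assumes "\<And>x. \<tau> x \<noteq> 0 \<Longrightarrow> 0 < \<rho> x"
  shows "(LINT x:star_region \<rho>|lborel. h x * \<tau> x) = (LINT x|lborel. h x * \<tau> x)"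
proof -
  have "\<tau> x = 0" if "\<not> 0 < \<rho> x" for x using assms that by blast
  then show ?thesis
    unfolding set_lebesgue_integral_def
    by (intro Bochner_Integration.integral_cong) (auto simp: indicator_def star_region_def)
qed

lemma X1_support: "\<tau> \<in> X1 A \<rho> \<Longrightarrow> \<tau> x \<noteq> 0 \<Longrightarrow> 0 < \<rho> x"
  by (auto simp: X1_def star_region_def)

text \<open>The weight decreases in \<rho>, so on the star it is at least its value \<kappa> at the
  upper bound \<open>M\<close>. The estimate
  \<open>\<bar>\<tau> x\<bar> \<le> 1 + (\<tau> x)\<^sup>2\<close> then suffices, the constant 1
  being integrable over the ball that contains the star.\<close>

lemma X1_integrable:
  assumes \<tau>: "\<tau> \<in> X1 A \<rho>"
  shows "integrable lborel \<tau>"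
proof -
  have [measurable]: "\<tau> \<in> borel_measurable borel" using \<tau> by (simp add: X1_def)
  define \<kappa> where "\<kappa> = ddPhi A M"
  have "0 < M" using center_pos abs_le[of 0] by linarith
  then have \<kappa>: "0 < \<kappa>" using A_pos by (simp add: \<kappa>_def ddPhi_def)
  have \<kappa>_le: "\<kappa> \<le> ddPhi A (\<rho> x)" if "0 < \<rho> x" for x
    using that A_pos abs_le[of x] unfolding \<kappa>_def ddPhi_def by (intro mult_left_mono powr_mono2') auto
  let ?W = "\<lambda>x. indicator (star_region \<rho>) x *\<^sub>R (ddPhi A (\<rho> x) * (\<tau> x)\<^sup>2)"
  let ?h = "\<lambda>x. indicator (cball 0 C) x + 1 / \<kappa> * ?W x"
  have "integrable lborel ?W" using \<tau> by (simp add: X1_def set_integrable_def)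
  then have h: "integrable lborel ?h"
    by (intro Bochner_Integration.integrable_add integrable_indicator_cball integrable_mult_right)
  show ?thesis
  proof (rule Bochner_Integration.integrable_bound[OF h])
    have "norm (\<tau> x) \<le> norm (?h x)" for x
    proof (cases "\<tau> x = 0")
      case False
      then have x: "0 < \<rho> x" by (rule X1_support[OF \<tau>])
      have "\<bar>\<tau> x\<bar> \<le> 1 + (\<tau> x)\<^sup>2"
        using zero_le_power2[of "\<bar>\<tau> x\<bar> - 1"] zero_le_power2[of "\<tau> x"]
        by (simp add: power2_diff)
      also have "(\<tau> x)\<^sup>2 \<le> 1 / \<kappa> * (ddPhi A (\<rho> x) * (\<tau> x)\<^sup>2)"
        using \<kappa> mult_right_mono[OF \<kappa>_le[OF x], of "(\<tau> x)\<^sup>2"] by (simp add: field_simps)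
      finally have "\<bar>\<tau> x\<bar> \<le> ?h x"
        using x support[of x] by (simp add: star_region_def)
      then show ?thesis by simp
    qed simp
    then show "AE x in lborel. norm (\<tau> x) \<le> norm (?h x)" by (rule AE_I2)
  qed measurable
qed

text \<open>By \<open>ddPhi_mult_dir\<close> one factor \<open>dir\<close> compensates the weight
  and the other is bounded, so the weighted square is bounded with bounded support.\<close>

lemma dir_in_RB1: "dir \<in> RB1 A \<rho>"
proof -
  let ?K = "4 * A * (M powr (1/3) + (\<epsilon>\<^sup>2 * C\<^sup>2 + 4 * pi * M * C * (C + C)) / (4 * A)) * dir_bound"
  let ?W = "\<lambda>x. indicator (star_region \<rho>) x *\<^sub>R (ddPhi A (\<rho> x) * (dir x)\<^sup>2)"
  have "integrable lborel ?W"
  proof (rule Bochner_Integration.integrable_bound)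
    show "integrable lborel (\<lambda>x::real^3. ?K * indicator (cball 0 C) x)"
      by (intro integrable_mult_right integrable_indicator_cball)
    have "norm (?W x) \<le> norm (?K * indicator (cball 0 C) x)" for x
    proof (cases "0 < \<rho> x")
      case True
      have "\<bar>cbrt x + cbrt' x\<bar> \<le> M powr (1/3) + (\<epsilon>\<^sup>2 * C\<^sup>2 + 4 * pi * M * C * (C + C)) / (4 * A)"
        using cbrt_pos[OF True] cbrt_le[OF True] abs_cbrt'_le[OF True] by linarith
      then have "4 * A * \<bar>cbrt x + cbrt' x\<bar> * \<bar>dir x\<bar> \<le> ?K"
        using A_pos abs_dir_le[of x] by (intro mult_mono) auto
      moreover have "ddPhi A (\<rho> x) * (dir x)\<^sup>2 = 4 * A * (cbrt x + cbrt' x) * dir x"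
        unfolding ddPhi_mult_dir[OF True, symmetric] by (simp add: power2_eq_square)
      then have "\<bar>ddPhi A (\<rho> x) * (dir x)\<^sup>2\<bar> = 4 * A * \<bar>cbrt x + cbrt' x\<bar> * \<bar>dir x\<bar>"
        using A_pos by (simp add: abs_mult)
      ultimately have "\<bar>ddPhi A (\<rho> x) * (dir x)\<^sup>2\<bar> \<le> \<bar>?K\<bar>" by linarith
      then show ?thesis using True support[of x] by (simp add: star_region_def)
    qed (simp add: star_region_def)
    then show "AE x in lborel. norm (?W x) \<le> norm (?K * indicator (cball 0 C) x)" by (rule AE_I2)
    show "?W \<in> borel_measurable lborel" unfolding ddPhi_def by measurable
  qed
  then have "dir \<in> X1 A \<rho>"
    using dir_support axisymmetric_dir measurable_dir
    by (auto simp: X1_def set_integrable_def star_region_def)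
  moreover have "(LINT x:star_region \<rho>|lborel. dir x) = 0"
    using set_integral_star_region_eq[of dir "\<lambda>_. 1"] dir_support integral_dir by simp
  ultimately show ?thesis by (simp add: RB1_def)
qed

text \<open>The linearized equilibrium is integrated against \<tau>: the potential term cancels the
  double integral, and the constant pairs to zero with \<tau>.\<close>

lemma op_L_dir:
  assumes \<tau>: "\<tau> \<in> RB1 A \<rho>"
  shows "op_L A \<rho> dir \<tau> = 3 / 2 * \<epsilon>\<^sup>2 * (LINT x|lborel. (cyl_radius x)\<^sup>2 * \<tau> x)"
proof -
  have X: "\<tau> \<in> X1 A \<rho>" using \<tau> by (simp add: RB1_def)
  note supp = X1_support[OF X] and int = X1_integrable[OF X]
  have [measurable]: "\<tau> \<in> borel_measurable borel" using X by (simp add: X1_def)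
  have zero: "(LINT x|lborel. \<tau> x) = 0"
    using \<tau> set_integral_star_region_eq[of \<tau> "\<lambda>_. 1", OF supp] by (simp add: RB1_def)
  have bd: "dir y \<noteq> 0 \<Longrightarrow> norm y \<le> C" for y using support dir_support by fastforce
  \<comment> \<open>The variable of \<open>dir\<close> is made the inner one: the bounds on
    \<open>dir\<close> control its potential uniformly on the star, while \<tau> is known only to be
    integrable.\<close>
  let ?Q = "\<lambda>y x. \<tau> y * (dir x / norm (y - x))"
  have Q: "integrable (lborel \<Otimes>\<^sub>M lborel) (case_prod ?Q)"
  proof (rule lborel_pair.Fubini_integrable)
    show "case_prod ?Q \<in> borel_measurable (lborel \<Otimes>\<^sub>M lborel)" by measurable
    have "integrable lborel (\<lambda>x. ?Q y x)" for y
      by (intro integrable_mult_right integrable_newton[OF measurable_dir abs_dir_le bd C_nonneg])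
    then show "AE y in lborel. integrable lborel (\<lambda>x. case_prod ?Q (y, x))" by simp
    show "integrable lborel (\<lambda>y. LINT x|lborel. norm (case_prod ?Q (y, x)))"
    proof (rule Bochner_Integration.integrable_bound)
      let ?B = "4 * pi * dir_bound * (C + C)\<^sup>2"
      show "integrable lborel (\<lambda>y. \<tau> y * ?B)" by (intro integrable_mult_left int)
      have "norm (LINT x|lborel. norm (case_prod ?Q (y, x))) \<le> norm (\<tau> y * ?B)" for y
      proof (cases "\<tau> y = 0")
        case False
        have y: "norm y \<le> C" using support[of y] supp[OF False] by simp
        have "(LINT x|lborel. norm (case_prod ?Q (y, x))) = (LINT x|lborel. \<bar>\<tau> y\<bar> * (\<bar>dir x\<bar> / norm (y - x)))"
          by (simp add: abs_mult)
        also have "\<dots> = \<bar>\<tau> y\<bar> * (LINT x|lborel. \<bar>dir x\<bar> / norm (y - x))"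
          by (rule integral_mult_right_zero)
        also have "\<dots> \<le> \<bar>\<tau> y\<bar> * (4 * pi * dir_bound * (norm y + C)\<^sup>2)"
          by (intro mult_left_mono abs_newton_le[OF measurable_dir abs_dir_le bd C_nonneg]) auto
        also have "\<dots> \<le> \<bar>\<tau> y\<bar> * ?B"
          using y C_nonneg dir_bound_nonneg by (intro mult_left_mono power_mono) auto
        finally have "(LINT x|lborel. norm (case_prod ?Q (y, x))) \<le> \<bar>\<tau> y\<bar> * ?B" .
        moreover have "0 \<le> (LINT x|lborel. norm (case_prod ?Q (y, x)))" by simp
        moreover have "\<bar>?B\<bar> = ?B" using dir_bound_nonneg by simp
        ultimately show ?thesis by (simp only: real_norm_def abs_mult abs_of_nonneg)
      qed simp
      then show "AE y in lborel. norm (LINT x|lborel. norm (case_prod ?Q (y, x))) \<le> norm (\<tau> y * ?B)"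
        by (rule AE_I2)
    qed measurable
  qed
  have newton_int: "(LINT x|lborel. ?Q y x) = \<tau> y * newton dir y" for y
    by (simp only: integral_mult_right_zero newton_def)
  have N: "integrable lborel (\<lambda>y. newton dir y * \<tau> y)"
    using lborel_pair.integrable_fst'[OF Q] by (simp only: case_prod_conv newton_int mult.commute)
  have "(LINT p|(lborel \<Otimes>\<^sub>M lborel). dir (fst p) * \<tau> (snd p) / norm (fst p - snd p)) =
      (LINT p|(lborel \<Otimes>\<^sub>M lborel). (case p of (x, y) \<Rightarrow> case_prod ?Q (y, x)))"
    by (intro Bochner_Integration.integral_cong) (auto simp: norm_minus_commute)
  also have "\<dots> = (LINT p|(lborel \<Otimes>\<^sub>M lborel). case_prod ?Q p)"
    by (rule lborel_pair.integral_product_swap) measurable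
  also have "\<dots> = (LINT y|lborel. LINT x|lborel. case_prod ?Q (y, x))"
    by (rule lborel_pair.integral_fst'[OF Q, symmetric])
  also have "\<dots> = (LINT y|lborel. newton dir y * \<tau> y)"
    by (simp only: case_prod_conv newton_int mult.commute)
  finally have second: "(LINT p|(lborel \<Otimes>\<^sub>M lborel). dir (fst p) * \<tau> (snd p) / norm (fst p - snd p)) =
      (LINT y|lborel. newton dir y * \<tau> y)" .
  have "(LINT x:star_region \<rho>|lborel. ddPhi A (\<rho> x) * dir x * \<tau> x) =
      (LINT x|lborel. ddPhi A (\<rho> x) * dir x * \<tau> x)"
    by (rule set_integral_star_region_eq[OF supp])
  also have "\<dots> = (LINT x|lborel. newton dir x * \<tau> x + (3 / 2 * \<epsilon>\<^sup>2 * ((cyl_radius x)\<^sup>2 * \<tau> x) - c * \<tau> x))"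
  proof (rule Bochner_Integration.integral_cong[OF refl])
    fix x
    show "ddPhi A (\<rho> x) * dir x * \<tau> x =
        newton dir x * \<tau> x + (3 / 2 * \<epsilon>\<^sup>2 * ((cyl_radius x)\<^sup>2 * \<tau> x) - c * \<tau> x)"
    proof (cases "\<tau> x = 0")
      case False
      show ?thesis
        unfolding linearized_equilibrium[OF supp[OF False]] by (simp add: algebra_simps)
    qed simp
  qed
  also have "\<dots> = (LINT x|lborel. newton dir x * \<tau> x) +
      (3 / 2 * \<epsilon>\<^sup>2 * (LINT x|lborel. (cyl_radius x)\<^sup>2 * \<tau> x) - c * (LINT x|lborel. \<tau> x))"
  proof -
    have i1: "integrable lborel (\<lambda>x. 3 / 2 * \<epsilon>\<^sup>2 * ((cyl_radius x)\<^sup>2 * \<tau> x))"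
      by (intro integrable_mult_right integrable_cyl_radius_square_mult[OF int supp])
    have i2: "integrable lborel (\<lambda>x. c * \<tau> x)"
      by (intro integrable_mult_right int)
    show ?thesis
      unfolding Bochner_Integration.integral_add[OF N Bochner_Integration.integrable_diff[OF i1 i2]]
        Bochner_Integration.integral_diff[OF i1 i2] integral_mult_right_zero ..
  qed
  finally show ?thesis by (simp add: op_L_def second zero)
qed

lemma op_G_dir:
  assumes \<tau>: "\<tau> \<in> RB1 A \<rho>"
  shows "op_G A \<epsilon> \<rho> dir \<tau> = 0"
proof -
  have X: "\<tau> \<in> X1 A \<rho>" using \<tau> by (simp add: RB1_def)
  have "(LINT x|lborel. \<tau> x) = 0"
    using \<tau> set_integral_star_region_eq[of \<tau> "\<lambda>_. 1", OF X1_support[OF X]] by (simp add: RB1_def)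
  then have "op_T \<rho> dir \<tau> = - 1 / (4 * pi) * (LINT x|lborel. (cyl_radius x)\<^sup>2 * \<tau> x)"
    using X by (intro op_T_dir X1_integrable X1_support[OF X]) (auto simp: X1_def)
  \<comment> \<open>The terms cancel since 6 pi times 1/(4 pi) equals the 3/2 of
    \<open>op_L_dir\<close>.\<close>
  then show ?thesis
    by (simp add: op_G_def op_L_dir[OF \<tau>])
qed

end

section \<open>From admissible rotating stars to star profiles\<close>

text \<open>The radial graph \<open>Rb\<close> of the surface yields star-shapedness and a bounded
  support; boundedness of \<rho> follows by compactness, and the equilibrium equation only changes
  its notation.\<close>

lemma rotating_star_imp_star_profile:
  assumes A: "0 < A" and \<mu>: "0 < \<mu>" and star: "rotating_star A \<mu> \<epsilon> \<rho>"
  obtains M C where "star_profile \<rho> M C A \<epsilon> (- potential \<rho> (cyl_point 0 (pole_height \<rho>)))"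
proof -
  let ?c = "- potential \<rho> (cyl_point 0 (pole_height \<rho>))"
  have ad: "admissible \<mu> \<rho>"
    and eq: "\<And>x. 0 < \<rho> x \<Longrightarrow> - 1/2 * \<epsilon>\<^sup>2 * (cyl_radius x)\<^sup>2 + dPhi A (\<rho> x) + potential \<rho> x + ?c = 0"
    using star unfolding rotating_star_def Let_def star_region_def by blast+
  have nonneg: "\<And>x. 0 \<le> \<rho> x" and ax: "axisymmetric \<rho>" and cont: "continuous_on UNIV \<rho>" and center: "\<rho> 0 = \<mu>"
    using ad unfolding admissible_def by blast+
  obtain R0 C Rb where C: "0 < R0" "R0 < C" "Rb ` {-1..1} \<subseteq> {R0..C}"
    and Rb: "\<forall>R\<ge>0. \<forall>\<zeta>\<in>{-1..1}. 0 < \<rho> (sph_point R \<zeta>) \<longleftrightarrow> R < Rb \<zeta>"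
    using ad unfolding admissible_def by (elim conjE exE) (rule that)
  \<comment> \<open>The graph condition concerns points of a half-plane and is carried to all of
    space by axial symmetry. The origin is left out because it has no direction; there positivity
    comes from the central density.\<close>
  have graph: "(0 < \<rho> x \<longleftrightarrow> norm x < Rb (x $ 3 / norm x)) \<and> x $ 3 / norm x \<in> {-1..1}" if "x \<noteq> 0" for x
  proof -
    let ?\<zeta> = "x $ 3 / norm x"
    have le: "\<bar>x $ 3\<bar> \<le> norm x" by (rule component_le_norm_cart)
    have \<zeta>: "?\<zeta> \<in> {-1..1}"
      using le that by (auto simp: divide_le_eq le_divide_eq abs_le_iff)
    have "norm x * sqrt (1 - ?\<zeta>\<^sup>2) = sqrt ((norm x)\<^sup>2 * (1 - ?\<zeta>\<^sup>2))"
      by (simp add: real_sqrt_mult)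
    also have "(norm x)\<^sup>2 * (1 - ?\<zeta>\<^sup>2) = (norm x)\<^sup>2 - (x $ 3)\<^sup>2"
      using that by (simp add: power_divide right_diff_distrib)
    also have "\<dots> = (cyl_radius x)\<^sup>2"
      by (simp add: norm_eq_cyl_radius)
    finally have "sph_point (norm x) ?\<zeta> = cyl_point (cyl_radius x) (x $ 3)"
      using that by (simp add: sph_point_def)
    then show ?thesis
      using Rb[rule_format, OF norm_ge_zero \<zeta>, of x] axisymmetric_cyl_point[OF ax, of x] \<zeta> by simp
  qed
  have support: "norm x \<le> C" if "0 < \<rho> x" for x
  proof (cases "x = 0")
    case False
    have "Rb (x $ 3 / norm x) \<in> {R0..C}" using C(3) graph[OF False] by blast
    then show ?thesis using graph[OF False] that by simp
  qed (use C in simp)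
  have star_shaped: "0 < \<rho> (t *\<^sub>R x)" if "0 < \<rho> x" "0 \<le> t" "t \<le> 1" for x t
  proof (cases "t = 0 \<or> x = 0")
    case False
    then have x: "x \<noteq> 0" and tx: "t *\<^sub>R x \<noteq> 0" and t: "0 < t" using that by auto
    have "t * norm x \<le> 1 * norm x" using that by (intro mult_right_mono) auto
    also have "1 * norm x < Rb (x $ 3 / norm x)" using graph[OF x] that by simp
    \<comment> \<open>Scaling by a positive \<open>t\<close> keeps the direction, so both points are
      compared with the same value of \<open>Rb\<close>.\<close>
    finally show ?thesis
      using graph[OF tx] t by simp
  qed (use center \<mu> in auto)
  have "compact (\<rho> ` cball 0 C)"
    by (intro compact_continuous_image continuous_on_subset[OF cont]) auto
  then obtain M where M: "\<And>y. y \<in> cball 0 C \<Longrightarrow> \<bar>\<rho> y\<bar> \<le> M"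
    using compact_imp_bounded by (fastforce simp: bounded_iff)
  have "0 \<le> M" using M[of 0] C by simp
  have "\<bar>\<rho> y\<bar> \<le> M" for y
  proof (cases "0 < \<rho> y")
    case False
    then have "\<rho> y = 0" using nonneg[of y] by linarith
    then show ?thesis using \<open>0 \<le> M\<close> by simp
  qed (use M[of y] support[of y] in simp)
  moreover have "norm y \<le> C" if "\<rho> y \<noteq> 0" for y
    using support[of y] nonneg[of y] that by linarith
  moreover have "dPhi A (\<rho> x) = \<epsilon>\<^sup>2 / 2 * (cyl_radius x)\<^sup>2 + newton \<rho> x - ?c" if "0 < \<rho> x" for x
    using eq[OF that] by (simp add: newton_def potential_def)
  ultimately have "star_profile \<rho> M C A \<epsilon> ?c"
    using A \<mu> C cont nonneg ax center star_shaped by unfold_locales auto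
  then show thesis by (rule that)
qed

theorem lemma3p4:
  fixes A \<mu>0 \<mu>1 :: real
  assumes "0 < A" and "0 < \<mu>0" and "\<mu>0 < \<mu>1"
  shows "\<exists>\<epsilon>0>0. \<forall>\<mu>\<in>{\<mu>0..\<mu>1}. \<forall>\<epsilon>. 0 < \<epsilon> \<and> \<epsilon> < \<epsilon>0 \<longrightarrow>
    (\<forall>\<rho> :: real ^ 3 \<Rightarrow> real. rotating_star A \<mu> \<epsilon> \<rho> \<longrightarrow>
       (\<forall>\<delta>\<rho>\<in>RB1 A \<rho>. op_G A \<epsilon> \<rho> (self_similar_dir \<rho>) \<delta>\<rho> = 0) \<and>
       op_G A \<epsilon> \<rho> (self_similar_dir \<rho>) (self_similar_dir \<rho>) = 0 \<and>
       self_similar_dir \<rho> \<in> reduced_kernel A \<epsilon> \<rho>)"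
proof -
  have main: "(\<forall>\<delta>\<rho>\<in>RB1 A \<rho>. op_G A \<epsilon> \<rho> (self_similar_dir \<rho>) \<delta>\<rho> = 0) \<and> self_similar_dir \<rho> \<in> RB1 A \<rho>"
    if \<mu>: "\<mu> \<in> {\<mu>0..\<mu>1}" and star: "rotating_star A \<mu> \<epsilon> \<rho>" for \<mu> \<epsilon> \<rho>
  proof -
    have "0 < \<mu>" using \<mu> assms by auto
    then obtain M C where "star_profile \<rho> M C A \<epsilon> (- potential \<rho> (cyl_point 0 (pole_height \<rho>)))"
      using rotating_star_imp_star_profile[OF assms(1) _ star] by blast
    then interpret star_profile \<rho> M C A \<epsilon> "- potential \<rho> (cyl_point 0 (pole_height \<rho>))" .
    show ?thesis
      unfolding self_similar_dir_eq using op_G_dir dir_in_RB1 by blast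
  qed
  show ?thesis
    \<comment> \<open>\<open>main\<close> covers every \<epsilon> for which a star is given, so 1
      can serve as the threshold.\<close>
    using main by (intro exI[of _ 1]) (auto simp: reduced_kernel_def)
qed

end
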